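(* Let $t>0$. For every matrix $A=A^*\le0$, vector $b\ne0$, pole $q>0$ and degree $m$, $$\|e^{tA}b-u_m^{\rm SI}\|_2\le2\|b\|_2\,\mathcal E_m^{\rm rat}(t,q).$$ Consequently, if $q_m=\alpha m/t$ with $0<\alpha<\alpha_c=\frac{3\sqrt3}2$, then for any sequence of matrices $A_m=A_m^*\le0$ and vectors $b_m\ne0$, of arbitrary dimensions, with $u_m^{\rm SI}$ the degree-$m$ shift-and-invert approximation for $(A_m,b_m)$ with pole $q_m$, $$\limsup_{m\to\infty}\left(\frac{\|e^{tA_m}b_m-u_m^{\rm SI}\|_2}{\|b_m\|_2}\right)^{1/m}\le H_e(\alpha).$$ At $\alpha=\alpha_*=1/\sqrt2$, there is a constant $C>0$, independent of the matrix–vector sequence, such that $$\|e^{tA_m}b_m-u_m^{\rm SI}\|_2\le C\|b_m\|_2\,m^{-1/2}(\sqrt2-1)^m$$ for all sufficiently large $m$.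
   Context: $A=A^*\le0$ means a complex Hermitian negative semidefinite matrix. For $q>0$ and an integer $m\ge0$, $\mathcal R_m(q)=\left\{\frac{P_m(z)}{(q-z)^m}:\ P_m\text{ a polynomial},\ \deg P_m\le m\right\}$, and for $t>0$, $\mathcal E_m^{\rm rat}(t,q)=\inf_{r\in\mathcal R_m(q)}\sup_{z\le0}|e^{tz}-r(z)|$. The repeated shift-and-invert space is $$\mathcal Q_{m+1}(A,b;q)=\operatorname{span}\{b,(qI-A)^{-1}b,\dots,(qI-A)^{-m}b\}.$$ Let $V_{m+1}$ be a matrix whose columns form an orthonormal basis of this space (which may have dimension less than $m+1$), $A_{m+1}=V_{m+1}^*AV_{m+1}$, and $$u_m^{\rm SI}=V_{m+1}\exp(tA_{m+1})V_{m+1}^*b .$$ (If the space becomes invariant at an earlier degree, the approximation is exact and remains so at later degrees.) For $0<\alpha<\alpha_c$, $\zeta_\alpha$ is the unique root of $\alpha(\zeta^3-\zeta)+1=0$ in the open first quadrant, and $H_e(\alpha)=\left|\frac{\zeta_\alpha-1}{\zeta_\alpha+1}\right|\exp\bigl(\alpha\operatorname{Re}(\zeta_\alpha^2)\bigr)$. *)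

theory Defs
  imports
    "HOL-Complex_Analysis.Complex_Analysis"
    "HOL-Real_Asymp.Real_Asymp"
    "Jordan_Normal_Form.Schur_Decomposition"
    "Jordan_Normal_Form.DL_Rank"
begin

definition vec_norm2 :: "complex Matrix.vec \<Rightarrow> real" where
  "vec_norm2 v = L2_set (\<lambda>i. cmod (vec_index v i)) {..<dim_vec v}"

text \<open>\<open>A = A\<^sup>* \<le> 0\<close> in dimension \<open>n\<close>. For Hermitian \<open>A\<close> the form
  \<open>v\<^sup>* A v\<close> is real, so taking the real part only converts the type.\<close>

definition herm_nonpos :: "nat \<Rightarrow> complex Matrix.mat \<Rightarrow> bool" where
  "herm_nonpos n A \<longleftrightarrow> A \<in> carrier_mat n n \<and> mat_adjoint A = A \<and>
     (\<forall>v\<in>carrier_vec n. Re ((A *\<^sub>v v) \<bullet>c v) \<le> 0)"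

text \<open>The exponential series, summed entrywise, for a square matrix.\<close>

definition mat_exp :: "complex Matrix.mat \<Rightarrow> complex Matrix.mat" where
  "mat_exp A = Matrix.mat (dim_row A) (dim_col A) (\<lambda>ij. \<Sum>k. (A ^\<^sub>m k) $$ ij / fact k)"

definition rat_space :: "nat \<Rightarrow> real \<Rightarrow> (complex \<Rightarrow> complex) set" where
  "rat_space m q =
     {(\<lambda>z. poly P z / (complex_of_real q - z) ^ m) | P :: complex poly. degree P \<le> m}"

text \<open>For \<open>t, q > 0\<close> the supremum is over a bounded set of reals: \<open>exp (t z)\<close> is bounded on
  \<open>z \<le> 0\<close>, and so is every element of \<open>rat_space m q\<close>, its numerator having degree at most \<open>m\<close>.\<close>

definition rat_err :: "nat \<Rightarrow> real \<Rightarrow> real \<Rightarrow> real" where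
  "rat_err m t q = (INF r\<in>rat_space m q. SUP z\<in>{..0::real}.
     cmod (exp (complex_of_real (t * z)) - r (complex_of_real z)))"

text \<open>The library function \<open>mat_inverse\<close> returns an option; for \<open>q > 0\<close> and \<open>A = A\<^sup>* \<le> 0\<close> the
  matrix \<open>q I - A\<close> is invertible, so the inverse exists.\<close>

definition shift_inv :: "real \<Rightarrow> complex Matrix.mat \<Rightarrow> complex Matrix.mat" where
  "shift_inv q A = the (mat_inverse (complex_of_real q \<cdot>\<^sub>m 1\<^sub>m (dim_row A) - A))"

definition SI_space :: "nat \<Rightarrow> complex Matrix.mat \<Rightarrow> complex Matrix.vec \<Rightarrow> real \<Rightarrow> complex Matrix.vec set" where
  "SI_space m A b q =
     LinearCombinations.module.span class_ring (module_vec TYPE(complex) (dim_vec b))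
       ((\<lambda>j. (shift_inv q A ^\<^sub>m j) *\<^sub>v b) ` {..m})"

definition onb_matrix :: "nat \<Rightarrow> complex Matrix.vec set \<Rightarrow> complex Matrix.mat \<Rightarrow> bool" where
  "onb_matrix n S V \<longleftrightarrow> dim_row V = n \<and>
     (\<forall>i<dim_col V. \<forall>j<dim_col V. col V i \<bullet>c col V j = (if i = j then 1 else 0)) \<and>
     LinearCombinations.module.span class_ring (module_vec TYPE(complex) n) (set (cols V)) = S"

definition galerkin_exp ::
    "real \<Rightarrow> complex Matrix.mat \<Rightarrow> complex Matrix.vec \<Rightarrow> complex Matrix.mat \<Rightarrow> complex Matrix.vec" where
  "galerkin_exp t A b V =
     V *\<^sub>v (mat_exp (complex_of_real t \<cdot>\<^sub>m (mat_adjoint V * A * V)) *\<^sub>v (mat_adjoint V *\<^sub>v b))"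

definition SI_error ::
    "real \<Rightarrow> complex Matrix.mat \<Rightarrow> complex Matrix.vec \<Rightarrow> complex Matrix.mat \<Rightarrow> real" where
  "SI_error t A b V =
     vec_norm2 (mat_exp (complex_of_real t \<cdot>\<^sub>m A) *\<^sub>v b - galerkin_exp t A b V)"

text \<open>The number of columns of \<open>V\<close> is left free, as the space may have dimension less
  than \<open>m + 1\<close>.\<close>

definition SI_setup ::
    "nat \<Rightarrow> real \<Rightarrow> nat \<Rightarrow> complex Matrix.mat \<Rightarrow> complex Matrix.vec \<Rightarrow> complex Matrix.mat \<Rightarrow> bool" where
  "SI_setup m q n A b V \<longleftrightarrow>
     herm_nonpos n A \<and> b \<in> carrier_vec n \<and> b \<noteq> 0\<^sub>v n \<and> onb_matrix n (SI_space m A b q) V"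

definition zeta :: "real \<Rightarrow> complex" where
  "zeta \<alpha> = (THE \<zeta>. complex_of_real \<alpha> * (\<zeta> ^ 3 - \<zeta>) + 1 = 0 \<and> Re \<zeta> > 0 \<and> Im \<zeta> > 0)"

definition H_e :: "real \<Rightarrow> real" where
  "H_e \<alpha> = cmod ((zeta \<alpha> - 1) / (zeta \<alpha> + 1)) * exp (\<alpha> * Re ((zeta \<alpha>)\<^sup>2))"

end

theory Submission
  imports Defs "HOL-Probability.Characteristic_Functions"
begin

text \<open>
  The error bound is quasi-optimality of a Galerkin method. Every \<open>r = P / (q - z)\<^sup>m\<close> in
  \<^const>\<open>rat_space\<close> is reproduced exactly, because the shift-and-invert space is the polynomial
  Krylov space of \<open>(q I - A)\<^sup>-\<^sup>m b\<close> and the compression of \<open>A\<close> to it reproduces polynomials of degree at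
  most \<open>m\<close> (\<open>galerkin_poly_exact\<close>). The error is therefore that of \<open>e\<^sup>t\<^sup>z - r\<close> at \<open>A\<close> plus that at the
  compression of \<open>A\<close>. Both matrices are Hermitian and nonpositive, and the spectral theorem
  (\<open>herm_nonpos_spectral\<close>) bounds each part by the supremum over \<open>z \<le> 0\<close>.

  For the rate, put \<open>z = - q \<xi>\<^sup>2\<close> and \<open>\<tau> = q t\<close>, so that \<open>e\<^sup>t\<^sup>z = exp (- \<tau> \<xi>\<^sup>2)\<close>. An inverse Laplace formula
  (\<open>gaussian_eq_vertical_line_integral\<close>) writes this as a superposition of the kernels
  \<open>1 / (\<zeta> - i\<xi>) + 1 / (\<zeta> + i\<xi>)\<close> with weights \<open>exp (\<tau> \<zeta>\<^sup>2)\<close> over an arbitrary vertical line \<open>Re \<zeta> = a > 0\<close>. Each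
  kernel has an expansion in powers of \<open>\<phi> = (\<zeta> - 1) / (\<zeta> + 1)\<close> whose coefficients are, up to factors that
  depend on \<open>\<zeta>\<close> only, Chebyshev polynomials in \<open>(\<xi>\<^sup>2 - 1) / (\<xi>\<^sup>2 + 1)\<close>, that is, rational functions of \<open>z\<close>
  with their only pole at \<open>q\<close>. Cutting the expansion off at degree \<open>m\<close> costs at most \<open>2 \<bar>\<phi>\<bar>\<^sup>m / a\<close>
  (\<open>cauchy_kernel_truncation\<close>), hence the best error is at most \<open>1 / (\<pi> a)\<close> times the integral of
  \<open>\<bar>exp (\<tau> \<zeta>\<^sup>2)\<bar> \<bar>\<phi>\<bar>\<^sup>m\<close> over the line.

  For \<open>\<tau> = \<alpha> m\<close> this integrand is an \<open>m\<close>-th power \<open>G\<^sup>m\<close>. The saddle points of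
  \<open>exp (\<alpha> \<zeta>\<^sup>2) (\<zeta> - 1) / (\<zeta> + 1)\<close> solve \<open>\<alpha> (\<zeta>\<^sup>3 - \<zeta>) + 1 = 0\<close>, and on the vertical line through
  \<^term>\<open>zeta \<alpha>\<close> the modulus \<open>G\<close> is largest exactly at \<^term>\<open>zeta \<alpha>\<close> and its conjugate, with
  the value \<^term>\<open>H_e \<alpha>\<close> and Gaussian decay on both sides (\<open>saddle_point_majorant\<close>). Laplace's method then
  gives an error of order \<open>m\<^sup>-\<^sup>1\<^sup>/\<^sup>2\<close> times the \<open>m\<close>-th power of \<^term>\<open>H_e \<alpha>\<close> for every subcritical \<open>\<alpha>\<close>
  (\<open>rat_err_saddle_bound\<close>). The limit superior follows, and so does the last claim, since
  the rate at \<open>\<alpha> = 1 / sqrt 2\<close> is \<open>sqrt 2 - 1\<close>.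
\<close>

section \<open>The exponential as an integral over a vertical line\<close>

lemma has_bochner_integral_gaussian_fourier:
  fixes c x :: real
  assumes "c > 0"
  shows "has_bochner_integral lborel (\<lambda>y. complex_of_real (exp (- c * y\<^sup>2)) * cis (x * y))
           (of_real (sqrt (pi / c) * exp (- x\<^sup>2 / (4 * c))))"
proof -
  define k where "k = 1 / sqrt (2 * c)"
  have k: "k > 0" "k\<^sup>2 = 1 / (2 * c)"
    using assms by (auto simp: k_def power_divide)
  have [measurable]: "(\<lambda>y. cis (r * y)) \<in> borel_measurable borel" for r
    by (intro borel_measurable_continuous_onI continuous_intros)
  have int0: "integrable lborel (\<lambda>y. complex_of_real (std_normal_density y) * cis (k * x * y))"
  proof (rule Bochner_Integration.integrable_bound[of lborel std_normal_density])
    show "integrable lborel std_normal_density" by simp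
  qed (auto simp: norm_mult)
  have "(LBINT y. complex_of_real (std_normal_density y) * cis (k * x * y)) =
        char std_normal_distribution (k * x)"
    unfolding char_def
    by (subst integral_density) (auto simp: cis_conv_exp scaleR_conv_of_real mult_ac)
  also have "\<dots> = of_real (exp (- (k * x)\<^sup>2 / 2))"
    by (simp add: char_std_normal_distribution)
  finally have "has_bochner_integral lborel
      (\<lambda>y. complex_of_real (std_normal_density y) * cis (k * x * y)) (of_real (exp (- (k * x)\<^sup>2 / 2)))"
    using int0 by (simp add: has_bochner_integral_iff)
  moreover have "1 / k \<noteq> 0" using k by simp
  ultimately have "has_bochner_integral lborel
      (\<lambda>y. complex_of_real (std_normal_density (0 + 1 / k * y)) * cis (k * x * (0 + 1 / k * y)))
      (of_real (exp (- (k * x)\<^sup>2 / 2)) /\<^sub>R \<bar>1 / k\<bar>)"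
    by (subst (asm) lborel_has_bochner_integral_real_affine_iff[of "1/k" _ _ 0]) auto
  hence *: "has_bochner_integral lborel
      (\<lambda>y. of_real (sqrt (2 * pi)) * (complex_of_real (std_normal_density (y / k)) * cis (x * y)))
      (of_real (sqrt (2 * pi)) * (of_real (k * exp (- (k * x)\<^sup>2 / 2))))"
    using k by (intro has_bochner_integral_mult_right) (auto simp: scaleR_conv_of_real)
  have "sqrt (2 * pi) * std_normal_density (y / k) = exp (- c * y\<^sup>2)" for y
  proof -
    have "(y / k)\<^sup>2 / 2 = c * y\<^sup>2" using k by (simp add: power_divide)
    thus ?thesis by (simp add: std_normal_density_def)
  qed
  moreover have "sqrt (2 * pi) * (k * exp (- (k * x)\<^sup>2 / 2)) = sqrt (pi / c) * exp (- x\<^sup>2 / (4 * c))"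
  proof -
    have "(k * x)\<^sup>2 / 2 = x\<^sup>2 / (4 * c)" using k by (simp add: power_mult_distrib)
    moreover have "sqrt (2 * pi) * k = sqrt (pi / c)"
      by (simp add: k_def real_sqrt_mult real_sqrt_divide)
    ultimately show ?thesis by (metis mult.assoc minus_divide_left)
  qed
  ultimately show ?thesis using *
    by (simp only: mult.assoc[symmetric] of_real_mult[symmetric])
qed

lemma gaussian_integral_shift:
  fixes c d :: real
  assumes c: "c > 0"
  shows "has_bochner_integral lborel (\<lambda>y. exp (- c * (y + d)\<^sup>2)) (sqrt (pi / c))"
proof -
  have "has_bochner_integral lborel (\<lambda>y. Re (complex_of_real (exp (- c * y\<^sup>2)) * cis (0 * y)))
      (Re (of_real (sqrt (pi / c) * exp (- 0\<^sup>2 / (4 * c)))))"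
    by (intro has_bochner_integral_Re has_bochner_integral_gaussian_fourier c)
  hence "has_bochner_integral lborel (\<lambda>y. exp (- c * y\<^sup>2)) (sqrt (pi / c))" by simp
  thus ?thesis
    by (subst (asm) lborel_has_bochner_integral_real_affine_iff[of 1 _ _ d]) (auto simp: add_ac)
qed

lemma integrable_gaussian_vertical_line:
  fixes a \<tau> :: real
  assumes "\<tau> > 0"
  shows "integrable lborel (\<lambda>y. exp (\<tau> * (a\<^sup>2 - y\<^sup>2)))"
proof -
  have "integrable lborel (\<lambda>y. exp (- \<tau> * (y + 0)\<^sup>2))"
    using gaussian_integral_shift[OF assms, of 0] by (simp only: has_bochner_integral_iff)
  hence "integrable lborel (\<lambda>y. exp (\<tau> * a\<^sup>2) * exp (- \<tau> * y\<^sup>2))"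
    by (intro integrable_mult_right) simp
  moreover have "(\<lambda>y. exp (\<tau> * (a\<^sup>2 - y\<^sup>2))) = (\<lambda>y. exp (\<tau> * a\<^sup>2) * exp (- \<tau> * y\<^sup>2))"
    by (auto simp: fun_eq_iff algebra_simps simp flip: exp_add)
  ultimately show ?thesis by simp
qed

lemma has_bochner_integral_laplace_const:
  fixes w :: complex
  assumes "Re w > 0"
  shows "has_bochner_integral lborel (\<lambda>s. indicator {0..} s *\<^sub>R exp (- (of_real s * w))) (1 / w)"
proof -
  have w: "w \<noteq> 0" using assms by auto
  define F where "F s = - exp (- (of_real s * w)) / w" for s :: real
  have nrm: "cmod (exp (- (of_real s * w))) = exp (- (s * Re w))" for s by simp
  have lim0: "((\<lambda>s. exp (- (s * Re w))) \<longlongrightarrow> 0) at_top"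
    using assms by real_asymp
  have nn: "(\<integral>\<^sup>+s. ennreal (indicator {0..} s * exp (- (s * Re w))) \<partial>lborel) = ennreal (0 - (- 1 / Re w))"
  proof -
    have "(\<integral>\<^sup>+s\<in>{0..}. ennreal (exp (- (s * Re w))) \<partial>lborel) = ennreal (0 - (- exp (- (0 * Re w)) / Re w))"
    proof (rule nn_integral_FTC_atLeast)
      show "((\<lambda>s. - exp (- (s * Re w)) / Re w) \<longlongrightarrow> 0) at_top"
        using tendsto_divide[OF tendsto_minus[OF lim0] tendsto_const[of "Re w"]] assms by simp
      show "((\<lambda>s. - exp (- (s * Re w)) / Re w) has_real_derivative exp (- (x * Re w))) (at x)" for x
        using assms by (auto intro!: derivative_eq_intros)
    qed auto
    moreover have "(\<integral>\<^sup>+s. ennreal (indicator {0..} s * exp (- (s * Re w))) \<partial>lborel) =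
        (\<integral>\<^sup>+s\<in>{0..}. ennreal (exp (- (s * Re w))) \<partial>lborel)"
      by (intro nn_integral_cong) (auto simp: indicator_def)
    ultimately show ?thesis by simp
  qed
  have int_re: "integrable lborel (\<lambda>s. indicator {0..} s * exp (- (s * Re w)))"
    by (rule integrableI_nonneg) (auto simp: nn)
  have int: "integrable lborel (\<lambda>s. indicator {0..} s *\<^sub>R exp (- (of_real s * w)))"
    by (rule Bochner_Integration.integrable_bound[OF int_re]) (auto simp: indicator_def)
  have "(LBINT s=0..\<infinity>. exp (- (of_real s * w))) = 0 - (- 1 / w)"
  proof (rule interval_integral_FTC_integrable[where F = F])
    show "(F has_vector_derivative exp (- (of_real x * w))) (at x)" for x
      unfolding F_def using w by (auto intro!: derivative_eq_intros has_vector_derivative_real_field simp: )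
    show "set_integrable lborel (einterval 0 \<infinity>) (\<lambda>x. exp (- (complex_of_real x * w)))"
      unfolding set_integrable_def
      by (rule Bochner_Integration.integrable_bound[OF int_re])
         (auto intro!: AE_I2 simp: indicator_def einterval_def zero_ereal_def)
    have "isCont F 0" unfolding F_def using w by (intro continuous_intros) auto
    hence "(F \<longlongrightarrow> F 0) (at_right 0)" by (meson continuous_within filterlim_at_split isCont_def)
    moreover have "F 0 = - 1 / w" by (simp add: F_def)
    ultimately show "((F \<circ> real_of_ereal) \<longlongrightarrow> - 1 / w) (at_right 0)"
      by (simp add: ereal_tendsto_simps1 zero_ereal_def)
    have "((\<lambda>s. cmod (F s)) \<longlongrightarrow> 0) at_top"
      using tendsto_divide[OF lim0 tendsto_const[of "cmod w"]] w by (simp add: F_def norm_divide)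
    hence "(F \<longlongrightarrow> 0) at_top" by (simp only: tendsto_norm_zero_iff)
    thus "((F \<circ> real_of_ereal) \<longlongrightarrow> 0) (at_left \<infinity>)"
      by (simp add: ereal_tendsto_simps1)
  qed (auto intro!: continuous_intros)
  moreover have "(LBINT s=0..\<infinity>. exp (- (of_real s * w))) =
      (LBINT s. indicator {0..} s *\<^sub>R exp (- (of_real s * w)))"
  proof -
    have "AE s in lborel. indicat_real (einterval 0 \<infinity>) s *\<^sub>R exp (- (of_real s * w)) =
            indicat_real {0..} s *\<^sub>R exp (- (of_real s * w))"
      using AE_lborel_singleton[of "0::real"]
      by eventually_elim (auto simp: indicator_def einterval_def zero_ereal_def)
    thus ?thesis
      unfolding interval_lebesgue_integral_def set_lebesgue_integral_def
      by (simp, intro integral_cong_AE) auto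
  qed
  ultimately show ?thesis using int by (simp add: has_bochner_integral_iff)
qed

text \<open>Inserting \<open>1 / (\<zeta> - i\<xi>) = \<integral> exp (- s (\<zeta> - i\<xi>)) ds\<close> over \<open>s \<ge> 0\<close>, which is where \<open>Re \<zeta> > 0\<close> enters, and
exchanging the integrals leaves a Gaussian Fourier integral in \<open>y\<close>. The abscissa \<open>a\<close> disappears from
the result, so no contour has to be deformed.\<close>

lemma half_line_integral_inverse_gaussian:
  fixes a \<tau> \<xi> :: real
  assumes a: "a > 0" and \<tau>: "\<tau> > 0"
  defines "\<zeta> \<equiv> \<lambda>y::real. complex_of_real a + \<i> * of_real y"
  shows "has_bochner_integral lborel (\<lambda>y. exp (of_real \<tau> * (\<zeta> y)\<^sup>2) / (\<zeta> y - \<i> * of_real \<xi>))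
     (of_real (sqrt (pi / \<tau>)) *
       (LBINT s. indicator {0..} s *\<^sub>R (complex_of_real (exp (- (1 / (4 * \<tau>)) * s\<^sup>2)) * cis (\<xi> * s))))"
proof -
  define f where "f y s = indicator {0..} s *\<^sub>R
     (exp (of_real \<tau> * (\<zeta> y)\<^sup>2) * exp (- (of_real s * (\<zeta> y - \<i> * of_real \<xi>))))" for y s :: real
  define g where "g y = exp (\<tau> * (a\<^sup>2 - y\<^sup>2))" for y
  define h where "h s = indicat_real {0..} s * exp (- (s * a))" for s
  have h: "integrable lborel h"
  proof -
    have "integrable lborel (\<lambda>s. indicator {0..} s *\<^sub>R exp (- (of_real s * complex_of_real a)))"
      using has_bochner_integral_laplace_const[of "of_real a"] a
      by (simp add: has_bochner_integral_iff)
    from integrable_norm[OF this] show ?thesis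
      by (rule Bochner_Integration.integrable_cong[THEN iffD1, rotated -1]) (auto simp: h_def)
  qed
  have g: "integrable lborel g"
    unfolding g_def by (rule integrable_gaussian_vertical_line[OF \<tau>])
  have norm_f: "norm (f y s) = g y * h s" for y s
    by (auto simp: f_def g_def h_def \<zeta>_def norm_mult indicator_def power2_eq_square algebra_simps)
  have [measurable]: "case_prod f \<in> borel_measurable (lborel \<Otimes>\<^sub>M lborel)"
    unfolding f_def \<zeta>_def case_prod_beta by measurable
  have int_fy: "integrable lborel (f y)" for y
    by (rule Bochner_Integration.integrable_bound[OF integrable_mult_right[OF h, of "g y"]])
       (auto simp: norm_f h_def g_def)
  have int_f: "integrable (lborel \<Otimes>\<^sub>M lborel) (case_prod f)"
  proof (rule lborel_pair.Fubini_integrable)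
    show "integrable lborel (\<lambda>x. LBINT y. norm (case_prod f (x, y)))"
      using g by (simp add: norm_f)
  qed (use int_fy in auto)
  have inner_s: "(LBINT s. f y s) = exp (of_real \<tau> * (\<zeta> y)\<^sup>2) / (\<zeta> y - \<i> * of_real \<xi>)" for y
  proof -
    have "has_bochner_integral lborel (\<lambda>s. exp (of_real \<tau> * (\<zeta> y)\<^sup>2) *
        (indicator {0..} s *\<^sub>R exp (- (of_real s * (\<zeta> y - \<i> * of_real \<xi>)))))
        (exp (of_real \<tau> * (\<zeta> y)\<^sup>2) * (1 / (\<zeta> y - \<i> * of_real \<xi>)))"
      by (intro has_bochner_integral_mult_right has_bochner_integral_laplace_const)
         (use a in \<open>auto simp: \<zeta>_def\<close>)
    thus ?thesis by (simp add: has_bochner_integral_iff f_def)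
  qed
  have inner_y: "(LBINT y. f y s) = of_real (sqrt (pi / \<tau>)) * (indicator {0..} s *\<^sub>R
       (complex_of_real (exp (- (1 / (4 * \<tau>)) * s\<^sup>2)) * cis (\<xi> * s)))" for s
  proof -
    define w where "w = indicat_real {0..} s *\<^sub>R (of_real (exp (\<tau> * a\<^sup>2 - s * a)) * cis (\<xi> * s))"
    have "f y s = w * (complex_of_real (exp (- \<tau> * y\<^sup>2)) * cis ((2 * \<tau> * a - s) * y))" for y
    proof -
      have "of_real \<tau> * (\<zeta> y)\<^sup>2 + - (of_real s * (\<zeta> y - \<i> * of_real \<xi>)) =
          of_real (\<tau> * a\<^sup>2 - s * a) + \<i> * of_real (\<xi> * s) + (of_real (- \<tau> * y\<^sup>2) +
          \<i> * of_real ((2 * \<tau> * a - s) * y))"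
        by (simp add: \<zeta>_def algebra_simps power2_eq_square)
      hence "exp (of_real \<tau> * (\<zeta> y)\<^sup>2) * exp (- (of_real s * (\<zeta> y - \<i> * of_real \<xi>))) =
          of_real (exp (\<tau> * a\<^sup>2 - s * a)) * cis (\<xi> * s) *
          (complex_of_real (exp (- \<tau> * y\<^sup>2)) * cis ((2 * \<tau> * a - s) * y))"
        by (simp only: exp_add[symmetric] cis_conv_exp exp_of_real[symmetric])
      thus ?thesis by (simp add: f_def w_def scaleR_conv_of_real mult_ac)
    qed
    moreover have "has_bochner_integral lborel
        (\<lambda>y. w * (complex_of_real (exp (- \<tau> * y\<^sup>2)) * cis ((2 * \<tau> * a - s) * y)))
        (w * of_real (sqrt (pi / \<tau>) * exp (- (2 * \<tau> * a - s)\<^sup>2 / (4 * \<tau>))))"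
      by (intro has_bochner_integral_mult_right has_bochner_integral_gaussian_fourier \<tau>)
    ultimately have "(LBINT y. f y s) =
        w * of_real (sqrt (pi / \<tau>) * exp (- (2 * \<tau> * a - s)\<^sup>2 / (4 * \<tau>)))"
      by (simp add: has_bochner_integral_iff)
    moreover have "exp (\<tau> * a\<^sup>2 - s * a) * exp (- (2 * \<tau> * a - s)\<^sup>2 / (4 * \<tau>)) =
        exp (- (1 / (4 * \<tau>)) * s\<^sup>2)"
    proof -
      have "(\<tau> * a\<^sup>2 - s * a) + (- (2 * \<tau> * a - s)\<^sup>2 / (4 * \<tau>)) = - (1 / (4 * \<tau>)) * s\<^sup>2"
        using \<tau> by (simp add: field_simps power2_eq_square)
      thus ?thesis by (simp only: exp_add[symmetric])
    qed
    ultimately show ?thesis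
      by (simp add: w_def scaleR_conv_of_real mult_ac flip: of_real_mult)
  qed
  have "integrable lborel (\<lambda>y. LBINT s. f y s)"
    using lborel_pair.integrable_fst'[OF int_f] by simp
  moreover have "(LBINT y. LBINT s. f y s) = (LBINT s. LBINT y. f y s)"
    using lborel_pair.Fubini_integral[of f] int_f by simp
  ultimately show ?thesis
    unfolding inner_s inner_y by (simp only: has_bochner_integral_iff integral_mult_right_zero)
qed

text \<open>The inverse Laplace formula for \<open>exp (- x)\<close> at \<open>x = \<tau> \<xi>\<^sup>2\<close>, in the variable \<open>\<zeta>\<close> with Laplace variable
\<open>\<tau> \<zeta>\<^sup>2\<close>: the vertical line is a parabola around the negative half-axis there. The two half-line
integrals for \<open>\<plusminus>\<xi>\<close> join to one Gaussian Fourier integral over the whole line. That \<open>a > 0\<close> is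
arbitrary is what later allows the line to run through the saddle point.\<close>

lemma gaussian_eq_vertical_line_integral:
  fixes a \<tau> \<xi> :: real
  assumes a: "a > 0" and \<tau>: "\<tau> > 0"
  defines "\<zeta> \<equiv> \<lambda>y::real. complex_of_real a + \<i> * of_real y"
  shows "has_bochner_integral lborel
     (\<lambda>y. exp (of_real \<tau> * (\<zeta> y)\<^sup>2) * (1 / (\<zeta> y - \<i> * of_real \<xi>) + 1 / (\<zeta> y + \<i> * of_real \<xi>)))
     (of_real (2 * pi * exp (- \<tau> * \<xi>\<^sup>2)))"
proof -
  define f where "f s = complex_of_real (exp (- (1 / (4 * \<tau>)) * s\<^sup>2)) * cis (\<xi> * s)" for s
  have f: "has_bochner_integral lborel f (of_real (sqrt (pi * (4 * \<tau>)) * exp (- \<tau> * \<xi>\<^sup>2)))"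
    using has_bochner_integral_gaussian_fourier[of "1 / (4 * \<tau>)" \<xi>] \<tau>
    unfolding f_def by (simp add: mult_ac)
  hence int_f: "integrable lborel f" by (simp add: has_bochner_integral_iff)
  have int_half: "integrable lborel (\<lambda>s. indicat_real S s *\<^sub>R f s)" if "S \<in> sets lborel" for S
    using int_f that by (intro integrable_mult_indicator)
  have reflect: "(LBINT s. indicator {0..} s *\<^sub>R (complex_of_real (exp (- (1 / (4 * \<tau>)) * s\<^sup>2)) * cis (- \<xi> * s))) =
        (LBINT s. indicator {..0} s *\<^sub>R f s)"
    by (subst lborel_integral_real_affine[of "-1" _ 0])
       (auto intro!: Bochner_Integration.integral_cong simp: f_def indicator_def)
  have "(LBINT s. indicator {0..} s *\<^sub>R f s) + (LBINT s. indicator {..0} s *\<^sub>R f s) =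
        (LBINT s. indicator {0..} s *\<^sub>R f s + indicator {..0} s *\<^sub>R f s)"
    by (intro Bochner_Integration.integral_add[symmetric] int_half) auto
  also have "\<dots> = (LBINT s. f s)"
  proof (rule integral_cong_AE)
    show "AE s in lborel. indicator {0..} s *\<^sub>R f s + indicator {..0} s *\<^sub>R f s = f s"
      using AE_lborel_singleton[of "0::real"] by eventually_elim (auto simp: indicator_def)
  qed (use int_f int_half in \<open>auto intro!: borel_measurable_add\<close>)
  also have "\<dots> = of_real (sqrt (pi * (4 * \<tau>)) * exp (- \<tau> * \<xi>\<^sup>2))"
    using f by (simp add: has_bochner_integral_iff)
  finally have sum: "(LBINT s. indicator {0..} s *\<^sub>R f s) + (LBINT s. indicator {..0} s *\<^sub>R f s) =
      of_real (sqrt (pi * (4 * \<tau>)) * exp (- \<tau> * \<xi>\<^sup>2))" .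
  have "sqrt (pi / \<tau>) * sqrt (pi * (4 * \<tau>)) = 2 * pi"
  proof -
    have "sqrt (pi / \<tau>) * sqrt (pi * (4 * \<tau>)) = sqrt ((2 * pi)\<^sup>2)"
      unfolding real_sqrt_mult[symmetric] using \<tau> by (simp add: power2_eq_square)
    thus ?thesis by (subst (asm) real_sqrt_abs) simp
  qed
  hence "complex_of_real (sqrt (pi / \<tau>)) * of_real (sqrt (pi * (4 * \<tau>)) * exp (- \<tau> * \<xi>\<^sup>2)) =
      of_real (2 * pi * exp (- \<tau> * \<xi>\<^sup>2))"
    by (simp only: of_real_mult[symmetric] mult.assoc[symmetric])
  moreover have "has_bochner_integral lborel
     (\<lambda>y. exp (of_real \<tau> * (\<zeta> y)\<^sup>2) / (\<zeta> y - \<i> * of_real \<xi>) +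
          exp (of_real \<tau> * (\<zeta> y)\<^sup>2) / (\<zeta> y - \<i> * of_real (- \<xi>)))
     (of_real (sqrt (pi / \<tau>)) * (LBINT s. indicator {0..} s *\<^sub>R f s) +
      of_real (sqrt (pi / \<tau>)) * (LBINT s. indicator {..0} s *\<^sub>R f s))"
    unfolding reflect[symmetric] unfolding f_def \<zeta>_def
    by (intro has_bochner_integral_add half_line_integral_inverse_gaussian a \<tau>)
  ultimately show ?thesis
    by (simp add: sum distrib_left[symmetric] del: of_real_mult) (simp add: distrib_left)
qed

section \<open>Rational approximation of the Cauchy kernel\<close>

text \<open>The two Cayley coordinates: \<open>cayley\<close> maps the right half-plane onto the unit disc and the imaginary
axis into the unit circle, and \<open>unimod \<xi>\<close> is the reciprocal of \<open>cayley\<close> at \<open>i\<xi>\<close>, the boundary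
point that corresponds to the spectral variable \<open>- q \<xi>\<^sup>2\<close>.\<close>

definition cayley :: "complex \<Rightarrow> complex" where
  "cayley \<zeta> = (\<zeta> - 1) / (\<zeta> + 1)"

definition unimod :: "real \<Rightarrow> complex" where
  "unimod \<xi> = (\<i> * of_real \<xi> + 1) / (\<i> * of_real \<xi> - 1)"

lemma imag_nonzero [simp]: "\<i> * of_real \<xi> - 1 \<noteq> 0" "\<i> * of_real \<xi> + 1 \<noteq> 0"
  by (auto simp: complex_eq_iff)

lemma unimod_minus: "unimod (- \<xi>) = 1 / unimod \<xi>"
proof -
  have "unimod (- \<xi>) = - (\<i> * of_real \<xi> - 1) / - (\<i> * of_real \<xi> + 1)"
    by (simp add: unimod_def)
  thus ?thesis by (simp only: unimod_def minus_divide_divide) simp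
qed

lemma norm_unimod [simp]: "cmod (unimod \<xi>) = 1"
proof -
  have "cmod (\<i> * of_real \<xi> + 1) = cmod (\<i> * of_real \<xi> - 1)"
    by (simp add: cmod_def)
  thus ?thesis by (simp add: unimod_def norm_divide)
qed

lemma one_minus_norm_cayley:
  assumes "Re \<zeta> > 0"
  shows "2 * Re \<zeta> / (cmod (\<zeta> + 1))\<^sup>2 \<le> 1 - cmod (cayley \<zeta>)" "cmod (cayley \<zeta>) < 1"
proof -
  have nz: "\<zeta> + 1 \<noteq> 0" using assms by (auto simp: complex_eq_iff)
  define c where "c = cmod (cayley \<zeta>)"
  have sq: "1 - c\<^sup>2 = 4 * Re \<zeta> / (cmod (\<zeta> + 1))\<^sup>2"
  proof -
    have "(cmod (\<zeta> + 1))\<^sup>2 - (cmod (\<zeta> - 1))\<^sup>2 = 4 * Re \<zeta>"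
      unfolding cmod_power2 by (simp add: power2_eq_square algebra_simps)
    moreover have "1 - c\<^sup>2 = ((cmod (\<zeta> + 1))\<^sup>2 - (cmod (\<zeta> - 1))\<^sup>2) / (cmod (\<zeta> + 1))\<^sup>2"
      using nz unfolding c_def cayley_def norm_divide power_divide by (simp add: diff_divide_distrib)
    ultimately show ?thesis by simp
  qed
  have pos: "4 * Re \<zeta> / (cmod (\<zeta> + 1))\<^sup>2 > 0" using assms nz by simp
  have c0: "c \<ge> 0" by (simp add: c_def)
  have "c\<^sup>2 < 1\<^sup>2" using sq pos by simp
  hence c1: "c < 1" using c0 by (simp add: power2_less_imp_less)
  thus "cmod (cayley \<zeta>) < 1" by (simp add: c_def)
  have "1 - c\<^sup>2 \<le> 2 * (1 - c)"
    using zero_le_power2[of "1 - c"] by (simp add: power2_eq_square algebra_simps)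
  thus "2 * Re \<zeta> / (cmod (\<zeta> + 1))\<^sup>2 \<le> 1 - cmod (cayley \<zeta>)"
    unfolding c_def[symmetric] sq by simp
qed

text \<open>In the Cayley coordinates the Cauchy kernel is a geometric series in \<open>\<phi>\<close>, whose tail is
\<open>- (1 - \<phi>)\<^sup>2 \<phi>\<^sup>m u\<^sup>m\<^sup>+\<^sup>1 / (2 (1 - \<phi> u))\<close>. The factor \<open>\<bar>1 - \<phi>\<bar>\<^sup>2 = 4 / \<bar>\<zeta> + 1\<bar>\<^sup>2\<close> compensates the degeneration
of \<open>1 - \<bar>\<phi>\<bar>\<close> as \<open>\<zeta>\<close> tends to infinity along a vertical line, so the bound is uniform in \<open>Im \<zeta>\<close>.\<close>

lemma cauchy_kernel_truncation:
  assumes \<zeta>: "Re \<zeta> > 0"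
  defines "\<phi> \<equiv> cayley \<zeta>"
  shows "cmod (1 / (\<zeta> - \<i> * of_real \<xi>) -
           (1 - \<phi>) / 2 * (1 - (1 - \<phi>) * (\<Sum>k<m. \<phi> ^ k * unimod \<xi> ^ Suc k)))
         \<le> cmod \<phi> ^ m / Re \<zeta>"
proof -
  define u where "u = unimod \<xi>"
  have nz: "\<zeta> + 1 \<noteq> 0" using \<zeta> by (auto simp: complex_eq_iff)
  have \<phi>1: "cmod \<phi> < 1" and \<phi>2: "2 * Re \<zeta> / (cmod (\<zeta> + 1))\<^sup>2 \<le> 1 - cmod \<phi>"
    using one_minus_norm_cayley[OF \<zeta>] by (auto simp: \<phi>_def)
  have "cmod (\<phi> * u) = cmod \<phi>" by (simp add: norm_mult u_def)
  hence nz'': "1 - \<phi> * u \<noteq> 0" using \<phi>1 by auto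
  have den: "1 - cmod \<phi> \<le> cmod (1 - \<phi> * u)"
    using norm_triangle_ineq2[of 1 "\<phi> * u"] \<open>cmod (\<phi> * u) = cmod \<phi>\<close> by simp
  have \<phi>': "1 - \<phi> = 2 / (\<zeta> + 1)" using nz by (simp add: \<phi>_def cayley_def field_simps)
  have kern: "1 / (\<zeta> - \<i> * of_real \<xi>) = (1 - \<phi>) / 2 * (1 - (1 - \<phi>) * (u / (1 - \<phi> * u)))"
  proof -
    define w where "w = \<i> * complex_of_real \<xi>"
    have w: "w - 1 \<noteq> 0" by (simp add: w_def)
    have u: "u = (w + 1) / (w - 1)" by (simp add: u_def unimod_def w_def)
    have a: "1 - \<phi> * u = 2 * (w - \<zeta>) / ((\<zeta> + 1) * (w - 1))"
      using nz w by (simp add: u \<phi>_def cayley_def divide_simps) (simp add: algebra_simps)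
    have b: "1 - u = - 2 / (w - 1)" using w by (simp add: u field_simps)
    have step: "1 - (1 - \<phi>) * (u / (1 - \<phi> * u)) = (1 - u) / (1 - \<phi> * u)"
      using nz'' by (simp add: field_simps)
    have "(1 - \<phi>) / 2 * (1 - (1 - \<phi>) * (u / (1 - \<phi> * u))) =
        2 / (\<zeta> + 1) / 2 * (- 2 / (w - 1) / (2 * (w - \<zeta>) / ((\<zeta> + 1) * (w - 1))))"
      unfolding step unfolding a b \<phi>' ..
    also have "\<dots> = - 1 / (w - \<zeta>)"
    proof -
      have "2 / p / 2 * (- 2 / r / (2 * d / (p * r))) = - 1 / d"
        if "p \<noteq> 0" "r \<noteq> 0" for p r d :: complex
        using that by (cases "d = 0") (auto simp: field_simps)
      from this[OF nz w] show ?thesis .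
    qed
    also have "\<dots> = 1 / (\<zeta> - w)"
      by (metis minus_diff_eq minus_divide_left minus_divide_right)
    finally show ?thesis unfolding w_def by (rule sym)
  qed
  have geo: "u / (1 - \<phi> * u) - (\<Sum>k<m. \<phi> ^ k * u ^ Suc k) = \<phi> ^ m * u ^ Suc m / (1 - \<phi> * u)"
  proof -
    have "(\<Sum>k<m. \<phi> ^ k * u ^ Suc k) = u * (\<Sum>k<m. (\<phi> * u) ^ k)"
      by (simp add: sum_distrib_left power_mult_distrib mult_ac)
    also have "(\<Sum>k<m. (\<phi> * u) ^ k) = (1 - (\<phi> * u) ^ m) / (1 - \<phi> * u)"
      using nz'' by (subst sum_gp_strict) auto
    finally show ?thesis using nz'' by (simp add: field_simps power_mult_distrib)
  qed
  have "1 / (\<zeta> - \<i> * of_real \<xi>) - (1 - \<phi>) / 2 * (1 - (1 - \<phi>) * (\<Sum>k<m. \<phi> ^ k * u ^ Suc k)) =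
        - ((1 - \<phi>)\<^sup>2 / 2) * (u / (1 - \<phi> * u) - (\<Sum>k<m. \<phi> ^ k * u ^ Suc k))"
  proof -
    have "(1 - \<phi>) / 2 * (1 - (1 - \<phi>) * x) - (1 - \<phi>) / 2 * (1 - (1 - \<phi>) * S) =
        - ((1 - \<phi>)\<^sup>2 / 2) * (x - S)" for x S
      by (simp add: field_simps power2_eq_square)
    thus ?thesis unfolding kern .
  qed
  also have "cmod \<dots> = (cmod (1 - \<phi>))\<^sup>2 / 2 * (cmod \<phi> ^ m / cmod (1 - \<phi> * u))"
    unfolding geo norm_mult norm_divide norm_minus_cancel norm_power by (simp add: u_def)
  also have "\<dots> \<le> (cmod (1 - \<phi>))\<^sup>2 / 2 * (cmod \<phi> ^ m / (2 * Re \<zeta> / (cmod (\<zeta> + 1))\<^sup>2))"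
  proof (intro mult_left_mono divide_left_mono mult_pos_pos)
    show "2 * Re \<zeta> / (cmod (\<zeta> + 1))\<^sup>2 \<le> cmod (1 - \<phi> * u)" using \<phi>2 den by linarith
    show "0 < cmod (1 - \<phi> * u)" using nz'' by simp
    show "0 < 2 * Re \<zeta> / (cmod (\<zeta> + 1))\<^sup>2" using \<zeta> nz by simp
  qed auto
  also have "\<dots> = cmod \<phi> ^ m / Re \<zeta>"
    using \<zeta> nz by (simp add: \<phi>' norm_divide field_simps)
  finally show ?thesis by (simp add: u_def)
qed

lemma rat_space_add:
  assumes "f \<in> rat_space m q" "g \<in> rat_space m q"
  shows "(\<lambda>z. f z + g z) \<in> rat_space m q"
proof -
  from assms obtain P R where "degree P \<le> m" "degree R \<le> m"
    "f = (\<lambda>z. poly P z / (of_real q - z) ^ m)" "g = (\<lambda>z. poly R z / (of_real q - z) ^ m)"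
    by (auto simp: rat_space_def)
  thus ?thesis unfolding rat_space_def
    by (intro CollectI exI[of _ "P + R"]) (auto simp: add_divide_distrib degree_add_le)
qed

lemma rat_space_scale:
  assumes "f \<in> rat_space m q"
  shows "(\<lambda>z. c * f z) \<in> rat_space m q"
proof -
  from assms obtain P where "degree P \<le> m" "f = (\<lambda>z. poly P z / (of_real q - z) ^ m)"
    by (auto simp: rat_space_def)
  thus ?thesis unfolding rat_space_def
    by (intro CollectI exI[of _ "Polynomial.smult c P"]) (auto intro: order.trans[OF degree_smult_le])
qed

lemma rat_space_sum:
  assumes "finite I" "\<And>i. i \<in> I \<Longrightarrow> f i \<in> rat_space m q"
  shows "(\<lambda>z. \<Sum>i\<in>I. f i z) \<in> rat_space m q"
  using assms
proof (induction rule: finite_induct)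
  case empty
  show ?case unfolding rat_space_def by (intro CollectI exI[of _ 0]) auto
next
  case (insert x F)
  thus ?case using rat_space_add[of "f x" m q] by simp
qed

text \<open>Since \<open>unimod (- \<xi>)\<close> is the inverse of \<open>unimod \<xi>\<close>, the left-hand side is \<open>2 T\<^sub>k (y)\<close> for the Chebyshev
polynomial \<open>T\<^sub>k\<close> at \<open>y = (\<xi>\<^sup>2 - 1) / (\<xi>\<^sup>2 + 1)\<close>, a rational function of \<open>z = - q \<xi>\<^sup>2\<close> with its only pole at
\<open>q\<close>. The three-term recurrence gives the numerators.\<close>

lemma chebyshev_numerator:
  fixes q :: real
  assumes q: "q > 0"
  shows "\<exists>P::complex poly. degree P \<le> k \<and> (\<forall>\<xi>. unimod \<xi> ^ k + unimod (- \<xi>) ^ k =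
           poly P (of_real (- q * \<xi>\<^sup>2)) / (of_real (q + q * \<xi>\<^sup>2)) ^ k)"
proof -
  have base: "unimod \<xi> + unimod (- \<xi>) =
     poly [:- 2 * of_real q, - 2:] (of_real (- q * \<xi>\<^sup>2)) / (of_real (q + q * \<xi>\<^sup>2))" for \<xi>
  proof -
    define w where "w = \<i> * complex_of_real \<xi>"
    have w: "w - 1 \<noteq> 0" "w + 1 \<noteq> 0" by (simp_all add: w_def)
    have w2: "of_real \<xi> ^ 2 = - w\<^sup>2" by (simp add: w_def power_mult_distrib)
    have "w\<^sup>2 \<noteq> 1" using w by (auto simp: power2_eq_1_iff add_eq_0_iff)
    hence nz: "of_real q + of_real q * (- w\<^sup>2) \<noteq> 0" using q by (simp add: algebra_simps)
    have "unimod \<xi> + unimod (- \<xi>) = (w + 1) / (w - 1) + (w - 1) / (w + 1)"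
      using w unfolding unimod_minus by (simp add: unimod_def w_def)
    also have "\<dots> = ((w + 1)\<^sup>2 + (w - 1)\<^sup>2) / (w\<^sup>2 - 1)"
      using w \<open>w\<^sup>2 \<noteq> 1\<close> by (simp add: divide_simps) (simp add: algebra_simps power2_eq_square)
    also have "\<dots> = (- 2 * of_real q + - 2 * (of_real (- q) * (- w\<^sup>2))) / (of_real q + of_real q * (- w\<^sup>2))"
      using nz \<open>w\<^sup>2 \<noteq> 1\<close> by (simp add: divide_simps) (simp add: algebra_simps power2_eq_square)
    finally show ?thesis by (simp add: w2 mult_ac)
  qed
  show ?thesis
proof (induction k rule: induct_nat_012)
  case 0
  show ?case by (intro exI[of _ "[:2:]"]) auto
next
  case 1
  show ?case by (intro exI[of _ "[:- 2 * of_real q, - 2:]"]) (use base in auto)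
next
  case (ge2 n)
  from ge2 obtain P R :: "complex poly" where P: "degree P \<le> n"
     "\<And>\<xi>. unimod \<xi> ^ n + unimod (- \<xi>) ^ n =
           poly P (of_real (- q * \<xi>\<^sup>2)) / (of_real (q + q * \<xi>\<^sup>2)) ^ n"
    and R: "degree R \<le> Suc n"
     "\<And>\<xi>. unimod \<xi> ^ Suc n + unimod (- \<xi>) ^ Suc n =
           poly R (of_real (- q * \<xi>\<^sup>2)) / (of_real (q + q * \<xi>\<^sup>2)) ^ Suc n"
    by blast
  define S where "S = [:- 2 * of_real q, - 2:] * R - [:of_real q, - 1:]\<^sup>2 * P"
  have "unimod \<xi> ^ Suc (Suc n) + unimod (- \<xi>) ^ Suc (Suc n) =
      poly S (of_real (- q * \<xi>\<^sup>2)) / (of_real (q + q * \<xi>\<^sup>2)) ^ Suc (Suc n)" for \<xi>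
  proof -
    define d where "d = complex_of_real (q + q * \<xi>\<^sup>2)"
    have "q + q * \<xi>\<^sup>2 > 0" using q by (simp add: add_pos_nonneg)
    hence d: "d \<noteq> 0" unfolding d_def of_real_eq_0_iff by linarith
    define z where "z = complex_of_real (- q * \<xi>\<^sup>2)"
    have dz: "poly [:of_real q, - 1:] z = d" by (simp add: d_def z_def)
    have uu: "unimod \<xi> * unimod (- \<xi>) = 1"
    proof -
      have "unimod \<xi> \<noteq> 0" by (metis norm_unimod norm_zero zero_neq_one)
      thus ?thesis by (simp add: unimod_minus)
    qed
    have rec: "x ^ Suc (Suc n) + y ^ Suc (Suc n) = (x + y) * (x ^ Suc n + y ^ Suc n) - (x ^ n + y ^ n)"
      if "x * y = 1" for x y :: complex
    proof -
      have "(x + y) * (x ^ Suc n + y ^ Suc n) =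
          x ^ Suc (Suc n) + y ^ Suc (Suc n) + (x * y) * (x ^ n + y ^ n)"
        by (simp add: algebra_simps)
      thus ?thesis using that by simp
    qed
    have "unimod \<xi> ^ Suc (Suc n) + unimod (- \<xi>) ^ Suc (Suc n) =
        poly [:- 2 * of_real q, - 2:] z / d * (poly R z / d ^ Suc n) - poly P z / d ^ n"
      unfolding rec[OF uu] R(2) P(2) base d_def z_def by simp
    also have "\<dots> = (poly [:- 2 * of_real q, - 2:] z * poly R z - d\<^sup>2 * poly P z) / d ^ Suc (Suc n)"
      using d by (simp add: field_simps power2_eq_square)
    also have "\<dots> = poly S z / d ^ Suc (Suc n)"
      unfolding S_def poly_diff poly_mult poly_power dz ..
    finally show ?thesis by (simp add: d_def z_def)
  qed
  moreover have "degree S \<le> Suc (Suc n)"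
  proof -
    have "degree ([:- 2 * complex_of_real q, - 2:] * R) \<le> 1 + degree R"
      by (rule order.trans[OF degree_mult_le]) (auto intro!: add_right_mono)
    moreover have "degree ([:complex_of_real q, - 1:]\<^sup>2 * P) \<le> 2 + degree P"
      by (rule order.trans[OF degree_mult_le])
         (auto intro!: add_right_mono order.trans[OF degree_power_le])
    ultimately show ?thesis using P(1) R(1) unfolding S_def
      by (intro degree_diff_le) auto
  qed
  ultimately show ?case by blast
qed
qed

text \<open>Makes the suprema in \<^const>\<open>rat_err\<close> meaningful: for \<open>i \<le> m\<close> the quotient \<open>\<bar>z\<bar>\<^sup>i / (q - z)\<^sup>m\<close> is at
most \<open>(q - z)\<^sup>i\<^sup>-\<^sup>m\<close>, which is largest at \<open>z = 0\<close>.\<close>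

lemma rat_space_bounded:
  assumes r: "r \<in> rat_space m q" and q: "q > 0" and t: "t \<ge> 0"
  shows "bdd_above ((\<lambda>z. cmod (exp (complex_of_real (t * z)) - r (complex_of_real z))) ` {..0::real})"
proof -
  from r obtain P where P: "degree P \<le> m" "r = (\<lambda>z. poly P z / (of_real q - z) ^ m)"
    by (auto simp: rat_space_def)
  have "cmod (exp (complex_of_real (t * z)) - r (complex_of_real z)) \<le>
      1 + (\<Sum>i\<le>degree P. cmod (coeff P i) / q ^ (m - i))" if z: "z \<le> 0" for z
  proof -
    have "t * z \<le> 0" using z t by (simp add: mult_nonneg_nonpos)
    hence 1: "cmod (exp (complex_of_real (t * z))) \<le> 1" by (simp add: norm_exp_eq_Re)
    have nrm: "cmod (of_real q - of_real z) = q - z"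
      using z q by (simp add: norm_of_real flip: of_real_diff)
    have term_le: "cmod (coeff P i * of_real z ^ i) / (q - z) ^ m \<le> cmod (coeff P i) / q ^ (m - i)"
      if "i \<le> m" for i
    proof -
      have "cmod (coeff P i * of_real z ^ i) / (q - z) ^ m =
          cmod (coeff P i) * (\<bar>z\<bar> ^ i / (q - z) ^ m)"
        by (simp add: norm_mult norm_power)
      also have "\<dots> \<le> cmod (coeff P i) * ((q - z) ^ i / (q - z) ^ m)"
        using z q by (intro mult_left_mono divide_right_mono power_mono) auto
      also have "(q - z) ^ i / (q - z) ^ m = 1 / (q - z) ^ (m - i)"
        using z q that by (simp add: power_diff)
      also have "\<dots> \<le> 1 / q ^ (m - i)"
        using z q by (intro divide_left_mono power_mono mult_pos_pos) auto
      finally show ?thesis by (simp add: mult_left_mono)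
    qed
    have "cmod (r (of_real z)) = cmod (\<Sum>i\<le>degree P. coeff P i * of_real z ^ i) / (q - z) ^ m"
      unfolding P(2) poly_altdef norm_divide norm_power nrm ..
    also have "\<dots> \<le> (\<Sum>i\<le>degree P. cmod (coeff P i * of_real z ^ i)) / (q - z) ^ m"
      using z q by (intro divide_right_mono norm_sum) auto
    also have "\<dots> \<le> (\<Sum>i\<le>degree P. cmod (coeff P i) / q ^ (m - i))"
      unfolding sum_divide_distrib using P(1) by (intro sum_mono term_le) auto
    finally show ?thesis using 1 by (intro order.trans[OF norm_triangle_ineq4] add_mono)
  qed
  thus ?thesis by (intro bdd_aboveI2) auto
qed

lemma rat_err_le:
  assumes r: "r \<in> rat_space m q" and q: "q > 0" and t: "t \<ge> 0"
    and B: "\<And>z. z \<le> 0 \<Longrightarrow> cmod (exp (complex_of_real (t * z)) - r (complex_of_real z)) \<le> B"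
  shows "rat_err m t q \<le> B"
proof -
  let ?E = "\<lambda>r z. cmod (exp (complex_of_real (t * z)) - r (complex_of_real z))"
  have "bdd_below ((\<lambda>r. SUP z\<in>{..0::real}. ?E r z) ` rat_space m q)"
  proof (rule bdd_belowI2[of _ 0])
    fix r assume "r \<in> rat_space m q"
    from cSUP_upper[OF _ rat_space_bounded[OF this q t], of 0]
    show "0 \<le> (SUP z\<in>{..0::real}. ?E r z)" by (auto intro: order.trans[OF norm_ge_zero])
  qed
  hence "rat_err m t q \<le> (SUP z\<in>{..0::real}. ?E r z)"
    unfolding rat_err_def by (intro cINF_lower r)
  also have "\<dots> \<le> B" using B by (intro cSUP_least) auto
  finally show ?thesis .
qed

text \<open>Truncating the kernel under the integral \<open>gaussian_eq_vertical_line_integral\<close> leaves an element of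
\<^const>\<open>rat_space\<close>: the truncated kernel is a combination of the functions of \<open>chebyshev_numerator\<close>
with \<open>k \<le> m\<close>, whose coefficients depend on \<open>y\<close> only, and these are integrated. The prefactor collects
\<open>1 / (2 \<pi>)\<close> from the integral formula and \<open>2 / a\<close> from the two truncation errors for \<open>\<plusminus>\<xi>\<close>.\<close>

lemma rat_err_le_vertical_line_integral:
  fixes a q t :: real
  assumes a: "a > 0" and q: "q > 0" and t: "t > 0"
  defines "\<zeta> \<equiv> \<lambda>y::real. complex_of_real a + \<i> * of_real y"
  shows "integrable lborel (\<lambda>y. exp (q * t * (a\<^sup>2 - y\<^sup>2)) * cmod (cayley (\<zeta> y)) ^ m)"
    and "rat_err m t q \<le> 1 / (pi * a) * (LBINT y. exp (q * t * (a\<^sup>2 - y\<^sup>2)) * cmod (cayley (\<zeta> y)) ^ m)"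
proof -
  define \<tau> where "\<tau> = q * t"
  have \<tau>: "\<tau> > 0" using q t by (simp add: \<tau>_def)
  define w where "w y = exp (of_real \<tau> * (\<zeta> y)\<^sup>2)" for y
  define \<phi> where "\<phi> y = cayley (\<zeta> y)" for y
  have re: "Re (\<zeta> y) = a" for y by (simp add: \<zeta>_def)
  have nz: "\<zeta> y + 1 \<noteq> 0" for y using a by (auto simp: complex_eq_iff \<zeta>_def)
  have norm_w: "cmod (w y) = exp (\<tau> * (a\<^sup>2 - y\<^sup>2))" for y
    by (simp add: w_def \<zeta>_def power2_eq_square)
  have norm_\<phi>: "cmod (\<phi> y) \<le> 1" for y
    unfolding \<phi>_def using one_minus_norm_cayley(2)[of "\<zeta> y"] a re by simp
  have cont: "continuous_on UNIV w" "continuous_on UNIV \<phi>"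
    unfolding w_def \<phi>_def cayley_def \<zeta>_def
    by (intro continuous_intros; use nz in \<open>simp add: \<zeta>_def\<close>)+
  hence [measurable]: "w \<in> borel_measurable borel" "\<phi> \<in> borel_measurable borel"
    by (auto intro: borel_measurable_continuous_onI)
  have int_w: "integrable lborel (\<lambda>y. exp (\<tau> * (a\<^sup>2 - y\<^sup>2)))"
    by (rule integrable_gaussian_vertical_line[OF \<tau>])
  have int_bd: "integrable lborel (\<lambda>y. w y * f y)"
    if [measurable]: "f \<in> borel_measurable borel" and f: "\<And>y. cmod (f y) \<le> B" for f B
  proof (rule Bochner_Integration.integrable_bound[OF integrable_mult_left[OF int_w, of B]])
    have "B \<ge> 0" using order.trans[OF norm_ge_zero f[of 0]] .
    thus "AE y in lborel. norm (w y * f y) \<le> norm (exp (\<tau> * (a\<^sup>2 - y\<^sup>2)) * B)"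
      by (auto simp: norm_mult norm_w f mult_left_mono)
  qed measurable
  have int_main: "integrable lborel (\<lambda>y. exp (\<tau> * (a\<^sup>2 - y\<^sup>2)) * cmod (\<phi> y) ^ m)"
    using integrable_norm[OF int_bd[of "\<lambda>y. \<phi> y ^ m" 1]] norm_\<phi>
    by (simp add: norm_mult norm_w norm_power power_le_one)
  thus "integrable lborel (\<lambda>y. exp (q * t * (a\<^sup>2 - y\<^sup>2)) * cmod (cayley (\<zeta> y)) ^ m)"
    by (simp add: \<phi>_def \<tau>_def)

  \<comment> \<open>The coefficient of \<open>u\<^sup>k\<close> in the truncated Cauchy kernel.\<close>
  define A where "A k y = (case k of 0 \<Rightarrow> (1 - \<phi> y) / 2 | Suc j \<Rightarrow> - ((1 - \<phi> y)\<^sup>2 / 2 * \<phi> y ^ j))" for k y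
  have [measurable]: "A k \<in> borel_measurable borel" for k
    unfolding A_def by (cases k) auto
  have \<phi>2: "cmod (1 - \<phi> y) \<le> 2" for y
    using norm_triangle_ineq4[of 1 "\<phi> y"] norm_\<phi>[of y] by simp
  have A_bd: "cmod (A k y) \<le> 2" for k y
  proof (cases k)
    case 0
    thus ?thesis using \<phi>2[of y] by (simp add: A_def norm_divide)
  next
    case (Suc j)
    have "(cmod (1 - \<phi> y))\<^sup>2 / 2 * cmod (\<phi> y) ^ j \<le> 2\<^sup>2 / 2 * 1"
      using \<phi>2[of y] norm_\<phi>[of y] by (intro mult_mono divide_right_mono power_mono power_le_one) auto
    thus ?thesis by (simp add: A_def Suc norm_mult norm_divide norm_power)
  qed
  define c where "c k = (LBINT y. w y * A k y) / (2 * of_real pi)" for k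
  have int_A: "integrable lborel (\<lambda>y. w y * A k y)" for k by (rule int_bd[OF _ A_bd]) auto

  have "\<exists>r. k \<le> m \<longrightarrow> r \<in> rat_space m q \<and> (\<forall>\<xi>. r (of_real (- q * \<xi>\<^sup>2)) = unimod \<xi> ^ k + unimod (- \<xi>) ^ k)" for k
  proof (cases "k \<le> m")
    case True
    from chebyshev_numerator[OF q, of k] obtain P where P: "degree P \<le> k"
      "\<And>\<xi>. unimod \<xi> ^ k + unimod (- \<xi>) ^ k =
           poly P (of_real (- q * \<xi>\<^sup>2)) / (of_real (q + q * \<xi>\<^sup>2)) ^ k" by blast
    define R where "R = P * [:of_real q, - 1:] ^ (m - k)"
    have "degree R \<le> degree P + degree ([:complex_of_real q, - 1:] ^ (m - k))"
      unfolding R_def by (rule degree_mult_le)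
    also have "\<dots> \<le> k + (m - k)"
      using P(1) by (intro add_mono order.trans[OF degree_power_le]) auto
    finally have "degree R \<le> m" using True by simp
    moreover have "poly R (of_real (- q * \<xi>\<^sup>2)) / (of_real q - of_real (- q * \<xi>\<^sup>2)) ^ m =
        unimod \<xi> ^ k + unimod (- \<xi>) ^ k" for \<xi>
    proof -
      define d where "d = complex_of_real (q + q * \<xi>\<^sup>2)"
      have "q + q * \<xi>\<^sup>2 > 0" using q by (simp add: add_pos_nonneg)
      hence d: "d \<noteq> 0" unfolding d_def of_real_eq_0_iff by linarith
      have "of_real q - of_real (- q * \<xi>\<^sup>2) = d" by (simp add: d_def)
      moreover have "poly R (of_real (- q * \<xi>\<^sup>2)) = poly P (of_real (- q * \<xi>\<^sup>2)) * d ^ (m - k)"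
        by (simp add: R_def d_def)
      moreover have "d ^ m = d ^ k * d ^ (m - k)" using True by (simp flip: power_add)
      ultimately show ?thesis using d unfolding P(2) by (simp add: d_def[symmetric])
    qed
    ultimately show ?thesis unfolding rat_space_def
      by (intro exI[of _ "\<lambda>z. poly R z / (of_real q - z) ^ m"]) blast
  qed auto
  hence "\<exists>T. \<forall>k. k \<le> m \<longrightarrow> T k \<in> rat_space m q \<and>
      (\<forall>\<xi>. T k (of_real (- q * \<xi>\<^sup>2)) = unimod \<xi> ^ k + unimod (- \<xi>) ^ k)"
    by (intro choice allI)
  then obtain T where T: "\<And>k. k \<le> m \<Longrightarrow> T k \<in> rat_space m q"
     "\<And>k \<xi>. k \<le> m \<Longrightarrow> T k (of_real (- q * \<xi>\<^sup>2)) = unimod \<xi> ^ k + unimod (- \<xi>) ^ k" by blast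
  define r where "r z = (\<Sum>k\<le>m. c k * T k z)" for z
  have "r \<in> rat_space m q"
    unfolding r_def by (intro rat_space_sum rat_space_scale T) auto
  moreover have "cmod (exp (complex_of_real (t * z)) - r (of_real z)) \<le>
      1 / (pi * a) * (LBINT y. exp (\<tau> * (a\<^sup>2 - y\<^sup>2)) * cmod (\<phi> y) ^ m)" if z: "z \<le> 0" for z
  proof -
    define \<xi> where "\<xi> = sqrt (- z / q)"
    have z_eq: "z = - q * \<xi>\<^sup>2" using z q by (simp add: \<xi>_def divide_nonpos_pos)
    define K where "K y = 1 / (\<zeta> y - \<i> * of_real \<xi>) + 1 / (\<zeta> y + \<i> * of_real \<xi>)" for y
    define S where "S y = (\<Sum>k\<le>m. A k y * T k (of_real z))" for y
    have K: "has_bochner_integral lborel (\<lambda>y. w y * K y) (of_real (2 * pi * exp (- \<tau> * \<xi>\<^sup>2)))"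
      unfolding w_def K_def \<zeta>_def by (rule gaussian_eq_vertical_line_integral[OF a \<tau>])
    have half: "(\<Sum>k\<le>m. A k y * u ^ k) =
        (1 - \<phi> y) / 2 * (1 - (1 - \<phi> y) * (\<Sum>k<m. \<phi> y ^ k * u ^ Suc k))" for y u
      proof -
      have "(\<Sum>k\<le>m. A k y * u ^ k) = A 0 y + (\<Sum>k<m. A (Suc k) y * u ^ Suc k)"
        by (simp add: lessThan_Suc_atMost[symmetric] sum.lessThan_Suc_shift del: sum.lessThan_Suc)
      also have "\<dots> = (1 - \<phi> y) / 2 - (1 - \<phi> y)\<^sup>2 / 2 * (\<Sum>k<m. \<phi> y ^ k * u ^ Suc k)"
        by (simp add: A_def sum_distrib_left sum_negf mult_ac)
      also have "\<dots> = (1 - \<phi> y) / 2 * (1 - (1 - \<phi> y) * (\<Sum>k<m. \<phi> y ^ k * u ^ Suc k))"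
        by (simp add: right_diff_distrib power2_eq_square)
      finally show ?thesis .
    qed
    have "S y = (\<Sum>k\<le>m. A k y * unimod \<xi> ^ k) + (\<Sum>k\<le>m. A k y * unimod (- \<xi>) ^ k)" for y
    proof -
      have "S y = (\<Sum>k\<le>m. A k y * (unimod \<xi> ^ k + unimod (- \<xi>) ^ k))"
        unfolding S_def z_eq by (intro sum.cong refl arg_cong[where f = "(*) _"] T) auto
      thus ?thesis by (simp add: distrib_left sum.distrib)
    qed
    note S_eq = this
    have KS: "cmod (K y - S y) \<le> 2 / a * cmod (\<phi> y) ^ m" for y
    proof -
      have "K y - S y = (1 / (\<zeta> y - \<i> * of_real \<xi>) - (\<Sum>k\<le>m. A k y * unimod \<xi> ^ k)) +
          (1 / (\<zeta> y - \<i> * of_real (- \<xi>)) - (\<Sum>k\<le>m. A k y * unimod (- \<xi>) ^ k))"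
        by (simp add: K_def S_eq)
      also have "cmod \<dots> \<le> cmod (\<phi> y) ^ m / Re (\<zeta> y) + cmod (\<phi> y) ^ m / Re (\<zeta> y)"
        unfolding half \<phi>_def using a re
        by (intro order.trans[OF norm_triangle_ineq] add_mono cauchy_kernel_truncation) auto
      finally show ?thesis by (simp add: re)
    qed
    have int_S: "has_bochner_integral lborel (\<lambda>y. w y * S y) (2 * of_real pi * r (of_real z))"
    proof -
      have "has_bochner_integral lborel (\<lambda>y. \<Sum>k\<le>m. w y * A k y * T k (of_real z))
          (\<Sum>k\<le>m. (LBINT y. w y * A k y) * T k (of_real z))"
        using int_A by (intro has_bochner_integral_sum has_bochner_integral_mult_left)
          (simp add: has_bochner_integral_iff)
      moreover have "(\<Sum>k\<le>m. (LBINT y. w y * A k y) * T k (of_real z)) = 2 * of_real pi * r (of_real z)"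
        by (simp add: r_def c_def sum_distrib_left)
      ultimately show ?thesis by (simp add: S_def sum_distrib_left mult_ac)
    qed
    have diff: "has_bochner_integral lborel (\<lambda>y. w y * (K y - S y))
        (of_real (2 * pi * exp (- \<tau> * \<xi>\<^sup>2)) - 2 * of_real pi * r (of_real z))"
      using has_bochner_integral_diff[OF K int_S] by (simp add: right_diff_distrib)
    have "t * z = - \<tau> * \<xi>\<^sup>2" by (simp add: z_eq \<tau>_def)
    hence "2 * of_real pi * (exp (complex_of_real (t * z)) - r (of_real z)) =
        of_real (2 * pi * exp (- \<tau> * \<xi>\<^sup>2)) - 2 * of_real pi * r (of_real z)"
      by (simp only: exp_of_real) (simp add: right_diff_distrib)
    also have "\<dots> = (LBINT y. w y * (K y - S y))" using diff by (simp add: has_bochner_integral_iff)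
    finally have eq: "2 * of_real pi * (exp (complex_of_real (t * z)) - r (of_real z)) =
        (LBINT y. w y * (K y - S y))" .
    have "2 * pi * cmod (exp (complex_of_real (t * z)) - r (of_real z)) =
        cmod (2 * of_real pi * (exp (complex_of_real (t * z)) - r (of_real z)))"
      by (simp add: norm_mult)
    also have "\<dots> = cmod (LBINT y. w y * (K y - S y))" by (simp only: eq)
    also have "\<dots> \<le> (LBINT y. norm (w y * (K y - S y)))"
      by (rule integral_norm_bound)
    also have "\<dots> \<le> (LBINT y. 2 / a * (exp (\<tau> * (a\<^sup>2 - y\<^sup>2)) * cmod (\<phi> y) ^ m))"
    proof (rule integral_mono)
      show "integrable lborel (\<lambda>y. norm (w y * (K y - S y)))"
        using diff by (intro integrable_norm) (simp add: has_bochner_integral_iff)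
      show "integrable lborel (\<lambda>y. 2 / a * (exp (\<tau> * (a\<^sup>2 - y\<^sup>2)) * cmod (\<phi> y) ^ m))"
        using int_main by (intro integrable_mult_right)
      show "norm (w y * (K y - S y)) \<le> 2 / a * (exp (\<tau> * (a\<^sup>2 - y\<^sup>2)) * cmod (\<phi> y) ^ m)" for y
        using mult_left_mono[OF KS[of y], of "exp (\<tau> * (a\<^sup>2 - y\<^sup>2))"]
        by (simp add: norm_mult norm_w mult_ac)
    qed
    also have "\<dots> = 2 / a * (LBINT y. exp (\<tau> * (a\<^sup>2 - y\<^sup>2)) * cmod (\<phi> y) ^ m)" by simp
    finally have "cmod (exp (complex_of_real (t * z)) - r (of_real z)) \<le>
        2 / a * (LBINT y. exp (\<tau> * (a\<^sup>2 - y\<^sup>2)) * cmod (\<phi> y) ^ m) / (2 * pi)"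
      by (subst pos_le_divide_eq) (simp_all add: mult_ac)
    thus ?thesis by (simp add: mult_ac)
  qed
  ultimately have "rat_err m t q \<le> 1 / (pi * a) * (LBINT y. exp (\<tau> * (a\<^sup>2 - y\<^sup>2)) * cmod (\<phi> y) ^ m)"
    using q t by (intro rat_err_le[of r]) auto
  thus "rat_err m t q \<le> 1 / (pi * a) * (LBINT y. exp (q * t * (a\<^sup>2 - y\<^sup>2)) * cmod (cayley (\<zeta> y)) ^ m)"
    by (simp add: \<tau>_def \<phi>_def)
qed

section \<open>The saddle point and the rate of rational approximation\<close>

text \<open>The real root of the cubic is \<open>- 2 a\<close>, where \<open>a = Re \<zeta>\<close>; Vieta's formulas give the two relations.
The second one, \<open>2 a (4 a\<^sup>2 - 1) = 1 / \<alpha>\<close>, has an increasing left-hand side for \<open>a > 1 / sqrt 3\<close>, whence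
existence and uniqueness, and its value at \<open>1 / sqrt 3\<close> is the reciprocal of the critical \<open>\<alpha>\<close>.\<close>

lemma zeta_saddle:
  fixes \<alpha> :: real
  assumes \<alpha>: "0 < \<alpha>" "\<alpha> < 3 * sqrt 3 / 2"
  obtains a b :: real where "a > 0" "b > 0" "b\<^sup>2 = 3 * a\<^sup>2 - 1" "\<alpha> * (2 * a * (4 * a\<^sup>2 - 1)) = 1"
    "zeta \<alpha> = of_real a + \<i> * of_real b"
proof -
  define f where "f x = 2 * x * (4 * x\<^sup>2 - 1)" for x :: real
  have f_less: "f x < f x'" if "0 < x" "x < x'" "3 * x\<^sup>2 > 1" for x x'
  proof -
    have "x\<^sup>2 < x'\<^sup>2" using that by (intro power_strict_mono) auto
    moreover have "0 \<le> 4 * x\<^sup>2 - 1" using that(3) zero_le_power2[of x] by linarith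
    ultimately show ?thesis unfolding f_def using that by (intro mult_strict_mono[of "2 * x"]) linarith+
  qed
  have root_iff: "of_real \<alpha> * ((of_real x + \<i> * of_real y) ^ 3 - (of_real x + \<i> * of_real y)) + 1 = 0
      \<longleftrightarrow> y\<^sup>2 = 3 * x\<^sup>2 - 1 \<and> \<alpha> * f x = 1" if "y > 0" for x y :: real
  proof -
    have "of_real \<alpha> * ((of_real x + \<i> * of_real y) ^ 3 - (of_real x + \<i> * of_real y)) + 1 =
        Complex (\<alpha> * (x ^ 3 - 3 * x * y\<^sup>2 - x) + 1) (\<alpha> * (y * (3 * x\<^sup>2 - 1 - y\<^sup>2)))"
      by (simp add: complex_eq_iff power3_eq_cube power2_eq_square algebra_simps)
    hence "of_real \<alpha> * ((of_real x + \<i> * of_real y) ^ 3 - (of_real x + \<i> * of_real y)) + 1 = 0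
        \<longleftrightarrow> \<alpha> * (x ^ 3 - 3 * x * y\<^sup>2 - x) + 1 = 0 \<and> y\<^sup>2 = 3 * x\<^sup>2 - 1"
      using that \<alpha> by (auto simp: complex_eq_iff)
    also have "\<dots> \<longleftrightarrow> y\<^sup>2 = 3 * x\<^sup>2 - 1 \<and> \<alpha> * f x = 1"
    proof -
      have "\<alpha> * (x ^ 3 - 3 * x * y\<^sup>2 - x) + 1 = 1 - \<alpha> * f x" if "y\<^sup>2 = 3 * x\<^sup>2 - 1"
        unfolding that f_def by (simp add: power3_eq_cube power2_eq_square algebra_simps)
      thus ?thesis by auto
    qed
    finally show ?thesis .
  qed
  have s3: "3 * (1 / sqrt 3)\<^sup>2 = (1::real)" by (simp add: power_divide)
  have f0: "f (1 / sqrt 3) < 1 / \<alpha>"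
  proof -
    have "f (1 / sqrt 3) = 2 / (3 * sqrt 3)" unfolding f_def using s3 by (simp add: power_divide)
    also have "\<dots> = 1 / (3 * sqrt 3 / 2)" by simp
    also have "\<dots> < 1 / \<alpha>" using \<alpha> by (intro divide_strict_left_mono mult_pos_pos) auto
    finally show ?thesis .
  qed
  have "1 / \<alpha> \<le> f (1 + 1 / \<alpha>)"
  proof -
    define x where "x = 1 + 1 / \<alpha>"
    have "1 / \<alpha> > 0" using \<alpha> by simp
    hence x: "x \<ge> 1" by (simp add: x_def)
    have "1 \<le> x\<^sup>2" using x by (rule one_le_power)
    moreover have "1 \<le> 2 * (4 * u - 1)" if "1 \<le> u" for u :: real using that by simp
    ultimately have "1 \<le> 2 * (4 * x\<^sup>2 - 1)" by blast
    hence "x * 1 \<le> x * (2 * (4 * x\<^sup>2 - 1))"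
      using x by (intro mult_left_mono[of 1]) linarith+
    moreover have "1 / \<alpha> \<le> x" by (simp add: x_def)
    ultimately show ?thesis by (simp add: f_def x_def[symmetric] mult_ac)
  qed
  moreover have "1 / sqrt 3 \<le> 1 + 1 / \<alpha>"
  proof -
    have "1 / sqrt 3 \<le> (1::real)" by simp
    also have "1 \<le> 1 + 1 / \<alpha>" using \<alpha> by simp
    finally show ?thesis .
  qed
  moreover have "continuous_on {1 / sqrt 3..1 + 1 / \<alpha>} f"
    unfolding f_def by (intro continuous_intros)
  ultimately obtain a where a: "1 / sqrt 3 \<le> a" "f a = 1 / \<alpha>"
    using f0 IVT'[of f "1 / sqrt 3" "1 / \<alpha>" "1 + 1 / \<alpha>"] by auto
  hence "1 / sqrt 3 < a" using f0 by (cases "a = 1 / sqrt 3") auto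
  hence a0: "a > 0" and "(1 / sqrt 3)\<^sup>2 < a\<^sup>2"
    by (auto intro!: power_strict_mono intro: less_trans[of 0 "1 / sqrt 3"])
  hence a1: "3 * a\<^sup>2 > 1" using s3 by linarith
  define b where "b = sqrt (3 * a\<^sup>2 - 1)"
  have b: "b > 0" "b\<^sup>2 = 3 * a\<^sup>2 - 1" using a1 by (auto simp: b_def)
  have \<alpha>f: "\<alpha> * f a = 1" using a \<alpha> by simp
  have "zeta \<alpha> = of_real a + \<i> * of_real b"
    unfolding zeta_def
  proof (rule the_equality, goal_cases)
    case 1
    show ?case using root_iff[of b a] b \<alpha>f a0 by simp
  next
    case (2 z)
    define x y where "x = Re z" and "y = Im z"
    have z: "z = of_real x + \<i> * of_real y" by (simp add: x_def y_def complex_eq_iff)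
    have xy: "x > 0" "y > 0" using 2 by (simp_all add: x_def y_def)
    have "y\<^sup>2 = 3 * x\<^sup>2 - 1" "\<alpha> * f x = 1" using 2 root_iff[of y x] xy unfolding z by auto
    moreover from this have "3 * x\<^sup>2 > 1" using zero_less_power[OF xy(2), of 2] by linarith
    moreover have "f x = f a" using \<open>\<alpha> * f x = 1\<close> \<alpha>f \<alpha> by (metis mult_left_cancel less_irrefl)
    ultimately have "x = a" using f_less[of x a] f_less[of a x] xy a0 a1 by (cases x a rule: linorder_cases) auto
    moreover have "y = b" using \<open>y\<^sup>2 = _\<close> \<open>x = a\<close> b xy by (metis power2_eq_imp_eq less_imp_le)
    ultimately show ?case by (simp add: z)
  qed
  from that[OF a0 b _ this] \<alpha>f show ?thesis by (simp add: f_def)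
qed

lemma norm_cayley_vertical_line:
  "cmod (cayley (of_real a + \<i> * of_real y)) = sqrt (((a - 1)\<^sup>2 + y\<^sup>2) / ((a + 1)\<^sup>2 + y\<^sup>2))"
proof -
  have "of_real a + \<i> * of_real y - 1 = Complex (a - 1) y"
    "of_real a + \<i> * of_real y + 1 = Complex (a + 1) y" by (auto simp: complex_eq_iff)
  thus ?thesis by (simp add: cayley_def norm_divide complex_norm real_sqrt_divide)
qed

text \<open>On the vertical line through the saddle point, \<open>ln G\<close> as a function of \<open>s = y\<^sup>2\<close> has the derivative
\<open>- \<alpha> (s - b\<^sup>2) (2 K + s + b\<^sup>2) / ((K + s)\<^sup>2 - 4 a\<^sup>2)\<close> with \<open>K = a\<^sup>2 + 1\<close>, while \<open>(s - b\<^sup>2)\<^sup>2 / (K + s)\<close> has the derivative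
\<open>(s - b\<^sup>2) (2 K + s + b\<^sup>2) / (K + s)\<^sup>2\<close>. Dropping \<open>- 4 a\<^sup>2\<close> in the denominator only flattens the slope on
either side of \<open>s = b\<^sup>2\<close>, so \<open>ln G\<close> falls off from its maximum, at the saddle points \<open>y = \<plusminus>b\<close>, at
least as fast as \<open>- \<alpha> (s - b\<^sup>2)\<^sup>2 / (K + s)\<close> does.\<close>

lemma saddle_point_majorant:
  fixes \<alpha> a b y :: real
  assumes \<alpha>: "\<alpha> > 0" and a: "a > 0" and b: "b\<^sup>2 = 3 * a\<^sup>2 - 1"
    and eq: "\<alpha> * (2 * a * (4 * a\<^sup>2 - 1)) = 1"
  defines "G \<equiv> \<lambda>y. exp (\<alpha> * (a\<^sup>2 - y\<^sup>2)) * cmod (cayley (of_real a + \<i> * of_real y))"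
  shows "G y \<le> G b * exp (- \<alpha> * (y\<^sup>2 - b\<^sup>2)\<^sup>2 / (a\<^sup>2 + 1 + y\<^sup>2))"
proof (cases "(a - 1)\<^sup>2 + y\<^sup>2 = 0")
  case True
  hence "G y = 0" by (simp add: G_def sum_power2_eq_zero_iff cayley_def)
  thus ?thesis by (simp add: G_def)
next
  case False
  hence y: "(a - 1)\<^sup>2 + y\<^sup>2 > 0" by (simp add: less_le)
  have \<alpha>': "2 * a = \<alpha> * (4 * a\<^sup>2 * (4 * a\<^sup>2 - 1))"
  proof -
    have "\<alpha> * (4 * a\<^sup>2 * (4 * a\<^sup>2 - 1)) = 2 * a * (\<alpha> * (2 * a * (4 * a\<^sup>2 - 1)))"
      by (simp add: power2_eq_square)
    thus ?thesis by (simp add: eq)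
  qed
  define K where "K = a\<^sup>2 + 1"
  \<comment> \<open>\<open>F (y\<^sup>2)\<close> is \<open>ln (G y)\<close> plus the claimed decay; it is maximal at \<open>s = b\<^sup>2\<close>.\<close>
  define F where "F s = \<alpha> * (a\<^sup>2 - s) + ln ((a - 1)\<^sup>2 + s) / 2 - ln ((a + 1)\<^sup>2 + s) / 2
      + \<alpha> * (s - b\<^sup>2)\<^sup>2 / (K + s)" for s
  define F' where "F' s = - (\<alpha> * (s - b\<^sup>2) * (2 * K + s + b\<^sup>2) *
      (4 * a\<^sup>2 / ((K + s)\<^sup>2 * (((a - 1)\<^sup>2 + s) * ((a + 1)\<^sup>2 + s)))))" for s
  have K: "K > 0" unfolding K_def by (simp add: add_nonneg_pos)
  have a1: "(a + 1)\<^sup>2 > 0" using a by simp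
  have deriv: "(F has_real_derivative F' s) (at s)" if s: "s \<ge> 0" "(a - 1)\<^sup>2 + s > 0" for s
  proof -
    define p r where "p = (a - 1)\<^sup>2 + s" and "r = (a + 1)\<^sup>2 + s"
    have pos: "p > 0" "r > 0" "K + s > 0" using s a1 K by (auto simp: p_def r_def add_pos_nonneg)
    have D: "(F has_real_derivative - \<alpha> + 1 / (2 * p) - 1 / (2 * r) +
         \<alpha> * (2 * (s - b\<^sup>2) * (K + s) - (s - b\<^sup>2)\<^sup>2) / (K + s)\<^sup>2) (at s)"
    proof -
      have 1: "((\<lambda>s. ln ((a - 1)\<^sup>2 + s) / 2) has_real_derivative 1 / (2 * p)) (at s)"
        using pos(1) unfolding p_def by (auto intro!: derivative_eq_intros simp: divide_simps)
      have 2: "((\<lambda>s. ln ((a + 1)\<^sup>2 + s) / 2) has_real_derivative 1 / (2 * r)) (at s)"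
        using pos(2) unfolding r_def by (auto intro!: derivative_eq_intros simp: divide_simps)
      have 3: "((\<lambda>s. \<alpha> * (s - b\<^sup>2)\<^sup>2 / (K + s)) has_real_derivative
          \<alpha> * (2 * (s - b\<^sup>2) * (K + s) - (s - b\<^sup>2)\<^sup>2) / (K + s)\<^sup>2) (at s)"
        using pos(3) by (auto intro!: derivative_eq_intros simp: power2_eq_square algebra_simps)
      have 4: "((\<lambda>s. \<alpha> * (a\<^sup>2 - s)) has_real_derivative - \<alpha>) (at s)"
        by (auto intro!: derivative_eq_intros)
      show ?thesis unfolding F_def by (rule DERIV_add DERIV_diff 1 2 3 4)+
    qed
    have "- \<alpha> + 1 / (2 * p) - 1 / (2 * r) = - (\<alpha> * (s - b\<^sup>2) * (2 * K + s + b\<^sup>2)) / (p * r)"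
    proof -
      have "- \<alpha> + 1 / (2 * p) - 1 / (2 * r) = (- \<alpha> * (p * r) + (r - p) / 2) / (p * r)"
        using pos by (simp add: field_simps)
      moreover have "(r - p) / 2 = 2 * a" by (simp add: r_def p_def power2_eq_square algebra_simps)
      moreover have "2 * a = \<alpha> * ((K + b\<^sup>2)\<^sup>2 - 4 * a\<^sup>2)"
        unfolding \<alpha>' K_def b by (simp add: power2_eq_square algebra_simps)
      moreover have pr: "p * r = (K + s)\<^sup>2 - 4 * a\<^sup>2"
        by (simp add: p_def r_def K_def power2_eq_square algebra_simps)
      have "- \<alpha> * (p * r) + \<alpha> * ((K + b\<^sup>2)\<^sup>2 - 4 * a\<^sup>2) =
          - (\<alpha> * (s - b\<^sup>2) * (2 * K + s + b\<^sup>2))"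
        unfolding pr by (simp add: power2_eq_square algebra_simps)
      ultimately show ?thesis by simp
    qed
    moreover have "2 * (s - b\<^sup>2) * (K + s) - (s - b\<^sup>2)\<^sup>2 = (s - b\<^sup>2) * (2 * K + s + b\<^sup>2)"
      by (simp add: power2_eq_square algebra_simps)
    moreover have "- (\<alpha> * (s - b\<^sup>2) * (2 * K + s + b\<^sup>2)) / (p * r) +
        \<alpha> * ((s - b\<^sup>2) * (2 * K + s + b\<^sup>2)) / (K + s)\<^sup>2 = F' s"
    proof -
      define c where "c = \<alpha> * (s - b\<^sup>2) * (2 * K + s + b\<^sup>2)"
      have "(K + s)\<^sup>2 - p * r = 4 * a\<^sup>2" by (simp add: p_def r_def K_def power2_eq_square algebra_simps)
      hence "F' s = - (c * (((K + s)\<^sup>2 - p * r) / ((K + s)\<^sup>2 * (p * r))))"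
        by (simp add: F'_def c_def p_def r_def)
      also have "\<dots> = - c / (p * r) + c / (K + s)\<^sup>2"
        using pos by (simp add: field_simps)
      finally show ?thesis by (simp add: c_def mult_ac)
    qed
    ultimately show ?thesis using D by simp
  qed
  have F'_factor: "\<exists>c\<ge>0. F' s = - (c * (s - b\<^sup>2))" if s: "s \<ge> 0" "(a - 1)\<^sup>2 + s > 0" for s
    using \<alpha> K s a1 unfolding F'_def
    by (intro exI[of _ "\<alpha> * (2 * K + s + b\<^sup>2) *
          (4 * a\<^sup>2 / ((K + s)\<^sup>2 * (((a - 1)\<^sup>2 + s) * ((a + 1)\<^sup>2 + s))))"])
       (auto intro!: mult_nonneg_nonneg divide_nonneg_nonneg simp: mult_ac)
  have "F (y\<^sup>2) \<le> F (b\<^sup>2)"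
  proof (cases "b\<^sup>2 \<le> y\<^sup>2")
    case True
    show ?thesis
    proof (rule DERIV_nonpos_imp_nonincreasing[OF True])
      fix s assume s: "b\<^sup>2 \<le> s" "s \<le> y\<^sup>2"
      have bp: "(a - 1)\<^sup>2 + b\<^sup>2 > 0"
      proof (rule ccontr)
        assume "\<not> (a - 1)\<^sup>2 + b\<^sup>2 > 0"
        hence "(a - 1)\<^sup>2 + b\<^sup>2 = 0" using zero_le_power2[of "a - 1"] zero_le_power2[of b] by linarith
        hence "a = 1" "b = 0" by (auto simp: sum_power2_eq_zero_iff)
        thus False using b by simp
      qed
      have "s \<ge> 0" "(a - 1)\<^sup>2 + s > 0" using s bp zero_le_power2[of b] by linarith+
      with deriv[OF this] F'_factor[OF this] s
      show "\<exists>y. DERIV F s :> y \<and> y \<le> 0" by (auto intro!: exI[of _ "F' s"] mult_nonneg_nonneg)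
    qed
  next
    case False
    hence *: "y\<^sup>2 \<le> b\<^sup>2" by simp
    show ?thesis
    proof (rule DERIV_nonneg_imp_nondecreasing[OF *])
      fix s assume s: "y\<^sup>2 \<le> s" "s \<le> b\<^sup>2"
      have "s \<ge> 0" "(a - 1)\<^sup>2 + s > 0" using s y zero_le_power2[of y] by linarith+
      with deriv[OF this] F'_factor[OF this] s
      show "\<exists>y. DERIV F s :> y \<and> 0 \<le> y"
        by (auto intro!: exI[of _ "F' s"] mult_nonneg_nonpos)
    qed
  qed
  moreover have G_exp: "G u = exp (F (u\<^sup>2) - \<alpha> * (u\<^sup>2 - b\<^sup>2)\<^sup>2 / (K + u\<^sup>2))"
    if "(a - 1)\<^sup>2 + u\<^sup>2 > 0" for u
  proof -
    have r: "(a + 1)\<^sup>2 + u\<^sup>2 > 0" using a1 by (simp add: add_pos_nonneg)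
    have "cmod (cayley (of_real a + \<i> * of_real u)) =
        exp (ln ((a - 1)\<^sup>2 + u\<^sup>2) / 2 - ln ((a + 1)\<^sup>2 + u\<^sup>2) / 2)"
      using that r unfolding norm_cayley_vertical_line
      by (simp add: exp_diff real_sqrt_divide flip: ln_sqrt)
    thus ?thesis by (simp add: G_def F_def flip: exp_add)
  qed
  moreover have "G b = exp (F (b\<^sup>2))"
  proof (cases "(a - 1)\<^sup>2 + b\<^sup>2 > 0")
    case True
    thus ?thesis by (simp add: G_exp)
  next
    case False
    hence "(a - 1)\<^sup>2 + b\<^sup>2 = 0" using zero_le_power2[of "a - 1"] zero_le_power2[of b] by linarith
    hence "a = 1" "b = 0" by (auto simp: sum_power2_eq_zero_iff)
    thus ?thesis using b by simp
  qed
  ultimately show ?thesis using y by (simp add: K_def flip: exp_add)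
qed

lemma H_e_saddle:
  assumes "zeta \<alpha> = of_real a + \<i> * of_real b"
  shows "H_e \<alpha> = exp (\<alpha> * (a\<^sup>2 - b\<^sup>2)) * cmod (cayley (of_real a + \<i> * of_real b))"
  unfolding H_e_def assms by (simp add: cayley_def power2_eq_square mult_ac)

lemma H_e_pos:
  assumes \<alpha>: "0 < \<alpha>" "\<alpha> < 3 * sqrt 3 / 2"
  shows "H_e \<alpha> > 0"
proof -
  from zeta_saddle[OF \<alpha>] obtain a b where ab: "b > 0" "zeta \<alpha> = of_real a + \<i> * of_real b" by metis
  hence "of_real a + \<i> * of_real b - 1 \<noteq> 0" "of_real a + \<i> * of_real b + 1 \<noteq> 0"
    by (auto simp: complex_eq_iff)
  thus ?thesis unfolding H_e_saddle[OF ab(2)] by (simp add: cayley_def)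
qed

lemma optimal_below_critical: "1 / sqrt 2 < 3 * sqrt 3 / (2::real)"
proof -
  have "1 / sqrt 2 \<le> (1::real)" by simp
  also have "1 < 3 * (1::real) / 2" by simp
  also have "\<dots> \<le> 3 * sqrt 3 / 2" by (intro divide_right_mono mult_left_mono) auto
  finally show ?thesis .
qed

text \<open>At \<open>\<alpha> = 1 / sqrt 2\<close> the saddle point is \<open>exp (i \<pi> / 4)\<close>: its square is imaginary, so only the Cayley
factor \<open>tan (\<pi> / 8)\<close> contributes.\<close>

lemma H_e_optimal: "H_e (1 / sqrt 2) = sqrt 2 - 1"
proof -
  from zeta_saddle[OF _ optimal_below_critical] obtain a b :: real where ab: "a > 0" "b > 0" "b\<^sup>2 = 3 * a\<^sup>2 - 1"
    "1 / sqrt 2 * (2 * a * (4 * a\<^sup>2 - 1)) = 1" "zeta (1 / sqrt 2) = of_real a + \<i> * of_real b" by auto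
  define x where "x = sqrt 2 * a"
  have a: "a = x / sqrt 2" by (simp add: x_def)
  have "x * (2 * x\<^sup>2 - 1) = 1" using ab(4) by (simp add: a power_divide field_simps)
  hence "(x - 1) * (2 * x\<^sup>2 + 2 * x + 1) = 0" by (simp add: algebra_simps power2_eq_square)
  moreover have "2 * x\<^sup>2 + 2 * x + 1 > 0" using ab(1) by (simp add: x_def add_pos_pos add_nonneg_pos)
  ultimately have "x = 1" by simp
  hence a: "a = 1 / sqrt 2" using a by simp
  hence a2: "a\<^sup>2 = 1 / 2" by (simp add: power_divide)
  hence b2: "b\<^sup>2 = 1 / 2" using ab(3) by simp
  have "(a - 1)\<^sup>2 + b\<^sup>2 = 2 - sqrt 2"
  proof -
    have "(a - 1)\<^sup>2 + b\<^sup>2 = a\<^sup>2 + b\<^sup>2 + 1 - 2 * a" by (simp add: power2_eq_square algebra_simps)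
    also have "2 * a = sqrt 2" by (simp add: a field_simps)
    finally show ?thesis by (simp add: a2 b2)
  qed
  moreover have "(a + 1)\<^sup>2 + b\<^sup>2 = 2 + sqrt 2"
  proof -
    have "(a + 1)\<^sup>2 + b\<^sup>2 = a\<^sup>2 + b\<^sup>2 + 1 + 2 * a" by (simp add: power2_eq_square algebra_simps)
    also have "2 * a = sqrt 2" by (simp add: a field_simps)
    finally show ?thesis by (simp add: a2 b2)
  qed
  moreover have "(2 - sqrt 2) / (2 + sqrt 2) = (sqrt 2 - 1)\<^sup>2"
  proof -
    have "2 + sqrt 2 > 0" by (simp add: add_pos_pos)
    moreover have "(sqrt 2 - 1)\<^sup>2 * (2 + sqrt 2) = 2 - sqrt 2"
      by (simp add: power2_eq_square algebra_simps)
    ultimately show ?thesis by (simp add: divide_eq_eq)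
  qed
  ultimately have "cmod (cayley (of_real a + \<i> * of_real b)) = \<bar>sqrt 2 - 1\<bar>"
    unfolding norm_cayley_vertical_line by simp
  thus ?thesis unfolding H_e_saddle[OF ab(5)] by (simp add: a2 b2)
qed

text \<open>With \<open>q t = \<alpha> m\<close> the integrand of \<open>rat_err_le_vertical_line_integral\<close> is the \<open>m\<close>-th power of a fixed
function \<open>G\<close>, whose maximum \<^term>\<open>H_e \<alpha>\<close> along the line through the saddle point is attained at the two
saddle points only. A Gaussian around each of them dominates \<open>G\<close>, so Laplace's method
contributes the factor \<open>m\<^sup>-\<^sup>1\<^sup>/\<^sup>2\<close>.\<close>

lemma rat_err_saddle_bound:
  fixes \<alpha> t :: real
  assumes \<alpha>: "0 < \<alpha>" "\<alpha> < 3 * sqrt 3 / 2" and t: "t > 0"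
  shows "\<exists>C>0. \<forall>m\<ge>1. rat_err m t (\<alpha> * real m / t) \<le> C * real m powr (- 1 / 2) * H_e \<alpha> ^ m"
proof -
  from zeta_saddle[OF \<alpha>] obtain a b :: real where ab: "a > 0" "b > 0" "b\<^sup>2 = 3 * a\<^sup>2 - 1"
    "\<alpha> * (2 * a * (4 * a\<^sup>2 - 1)) = 1" "zeta \<alpha> = of_real a + \<i> * of_real b" by metis
  define G where "G y = exp (\<alpha> * (a\<^sup>2 - y\<^sup>2)) * cmod (cayley (of_real a + \<i> * of_real y))" for y
  have Gb: "G b = H_e \<alpha>" by (simp add: G_def H_e_saddle[OF ab(5)])
  have G0: "G y \<ge> 0" for y by (simp add: G_def)
  \<comment> \<open>Rate of the Gaussians: \<open>(y\<^sup>2 - b\<^sup>2)\<^sup>2 = (\<bar>y\<bar> - b)\<^sup>2 (\<bar>y\<bar> + b)\<^sup>2\<close>, and \<open>(\<bar>y\<bar> + b)\<^sup>2 / (a\<^sup>2 + 1 + y\<^sup>2) \<ge> b\<^sup>2 / (a\<^sup>2 + 1 + b\<^sup>2)\<close>.\<close>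
  define \<kappa> where "\<kappa> = \<alpha> * (b\<^sup>2 / (a\<^sup>2 + 1 + b\<^sup>2))"
  have K: "a\<^sup>2 + 1 > 0" by (simp add: add_nonneg_pos)
  have \<kappa>: "\<kappa> > 0" using \<alpha> ab(2) K by (simp add: \<kappa>_def add_pos_pos)
  have G_le: "G y \<le> H_e \<alpha> * exp (- \<kappa> * (\<bar>y\<bar> - b)\<^sup>2)" for y
  proof -
    have "b\<^sup>2 / (a\<^sup>2 + 1 + b\<^sup>2) * (a\<^sup>2 + 1 + y\<^sup>2) \<le> y\<^sup>2 + b\<^sup>2"
    proof -
      have "b\<^sup>2 * (a\<^sup>2 + 1 + y\<^sup>2) \<le> (y\<^sup>2 + b\<^sup>2) * (a\<^sup>2 + 1 + b\<^sup>2)"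
      proof -
        have "(y\<^sup>2 + b\<^sup>2) * (a\<^sup>2 + 1 + b\<^sup>2) - b\<^sup>2 * (a\<^sup>2 + 1 + y\<^sup>2) = y\<^sup>2 * (a\<^sup>2 + 1) + b\<^sup>2 * b\<^sup>2"
          by (simp add: algebra_simps)
        also have "\<dots> \<ge> 0" using K by simp
        finally show ?thesis by simp
      qed
      thus ?thesis using K by (simp add: divide_le_eq add_pos_nonneg)
    qed
    also have "\<dots> \<le> (\<bar>y\<bar> + b)\<^sup>2" using ab(2) by (simp add: power2_sum)
    finally have "b\<^sup>2 / (a\<^sup>2 + 1 + b\<^sup>2) \<le> (\<bar>y\<bar> + b)\<^sup>2 / (a\<^sup>2 + 1 + y\<^sup>2)"
      using K by (simp add: le_divide_eq add_pos_nonneg)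
    hence "\<alpha> * (b\<^sup>2 / (a\<^sup>2 + 1 + b\<^sup>2)) * (\<bar>y\<bar> - b)\<^sup>2 \<le>
        \<alpha> * ((\<bar>y\<bar> + b)\<^sup>2 / (a\<^sup>2 + 1 + y\<^sup>2)) * (\<bar>y\<bar> - b)\<^sup>2"
      using \<alpha> by (intro mult_right_mono mult_left_mono) auto
    also have "\<dots> = \<alpha> * ((\<bar>y\<bar> + b) * (\<bar>y\<bar> - b))\<^sup>2 / (a\<^sup>2 + 1 + y\<^sup>2)"
      by (simp add: power_mult_distrib)
    also have "(\<bar>y\<bar> + b) * (\<bar>y\<bar> - b) = y\<^sup>2 - b\<^sup>2"
      by (simp add: algebra_simps power2_eq_square flip: abs_mult)
    finally have "- \<alpha> * (y\<^sup>2 - b\<^sup>2)\<^sup>2 / (a\<^sup>2 + 1 + y\<^sup>2) \<le> - \<kappa> * (\<bar>y\<bar> - b)\<^sup>2"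
      by (simp add: \<kappa>_def)
    hence "G b * exp (- \<alpha> * (y\<^sup>2 - b\<^sup>2)\<^sup>2 / (a\<^sup>2 + 1 + y\<^sup>2)) \<le> G b * exp (- \<kappa> * (\<bar>y\<bar> - b)\<^sup>2)"
      by (intro mult_left_mono G0) simp
    moreover have "G y \<le> G b * exp (- \<alpha> * (y\<^sup>2 - b\<^sup>2)\<^sup>2 / (a\<^sup>2 + 1 + y\<^sup>2))"
      unfolding G_def by (rule saddle_point_majorant[OF \<alpha>(1) ab(1,3,4)])
    ultimately show ?thesis unfolding Gb by linarith
  qed
  define C where "C = 2 / (pi * a) * sqrt (pi / \<kappa>)"
  have C: "C > 0" using ab \<kappa> by (simp add: C_def)
  moreover have "rat_err m t (\<alpha> * real m / t) \<le> C * real m powr (- 1 / 2) * H_e \<alpha> ^ m" if m: "m \<ge> 1" for m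
  proof -
    have m0: "real m > 0" using m by simp
    define q where "q = \<alpha> * real m / t"
    have q: "q > 0" using \<alpha> t m0 by (simp add: q_def)
    have qt: "q * t = \<alpha> * real m" using t by (simp add: q_def)
    define g where "g y = exp (- (\<kappa> * m) * (y + - b)\<^sup>2) + exp (- (\<kappa> * m) * (y + b)\<^sup>2)" for y
    have g: "has_bochner_integral lborel g (sqrt (pi / (\<kappa> * m)) + sqrt (pi / (\<kappa> * m)))"
      unfolding g_def using \<kappa> m0 by (intro has_bochner_integral_add gaussian_integral_shift) auto
    have Gm: "exp (q * t * (a\<^sup>2 - y\<^sup>2)) * cmod (cayley (of_real a + \<i> * of_real y)) ^ m = G y ^ m" for y
      unfolding G_def power_mult_distrib by (simp add: qt mult_ac flip: exp_of_nat_mult)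
    have G_pow_le: "G y ^ m \<le> H_e \<alpha> ^ m * g y" for y
    proof -
      have "G y ^ m \<le> (H_e \<alpha> * exp (- \<kappa> * (\<bar>y\<bar> - b)\<^sup>2)) ^ m" by (intro power_mono G_le G0)
      also have "\<dots> = H_e \<alpha> ^ m * exp (- (\<kappa> * m) * (\<bar>y\<bar> - b)\<^sup>2)"
        unfolding power_mult_distrib by (simp add: mult_ac flip: exp_of_nat_mult)
      also have "exp (- (\<kappa> * m) * (\<bar>y\<bar> - b)\<^sup>2) \<le> g y"
      proof (cases "y \<ge> 0")
        case False
        hence "(\<bar>y\<bar> - b)\<^sup>2 = (y + b)\<^sup>2" by (simp add: power2_eq_square algebra_simps)
        thus ?thesis by (simp add: g_def)
      qed (simp add: g_def)
      finally show ?thesis using H_e_pos[OF \<alpha>] by (simp add: mult_left_mono)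
    qed
    have "rat_err m t q \<le> 1 / (pi * a) * (LBINT y. G y ^ m)"
      using rat_err_le_vertical_line_integral(2)[OF ab(1) q t, of m] by (simp only: Gm)
    also have "\<dots> \<le> 1 / (pi * a) * (LBINT y. H_e \<alpha> ^ m * g y)"
    proof (intro mult_left_mono integral_mono)
      show "integrable lborel (\<lambda>y. G y ^ m)"
        using rat_err_le_vertical_line_integral(1)[OF ab(1) q t, of m] by (simp only: Gm)
      show "integrable lborel (\<lambda>y. H_e \<alpha> ^ m * g y)"
        using g by (intro integrable_mult_right) (simp add: has_bochner_integral_iff)
    qed (use G_pow_le ab(1) in auto)
    also have "\<dots> = 1 / (pi * a) * (H_e \<alpha> ^ m * (2 * sqrt (pi / (\<kappa> * m))))"
      using g by (simp add: has_bochner_integral_iff)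
    also have "sqrt (pi / (\<kappa> * m)) = sqrt (pi / \<kappa>) * real m powr (- 1 / 2)"
      using m0 by (simp add: real_sqrt_divide real_sqrt_mult powr_minus_divide powr_half_sqrt[symmetric])
    finally show ?thesis by (simp add: q_def C_def mult_ac)
  qed
  ultimately show ?thesis by blast
qed

section \<open>The spectral theorem and functional calculus\<close>

lemma mult_vec_index_sum:
  "A \<in> carrier_mat n k \<Longrightarrow> v \<in> carrier_vec k \<Longrightarrow> i < n \<Longrightarrow>
     vec_index (A *\<^sub>v v) i = (\<Sum>j<k. A $$ (i, j) * vec_index v j)"
  by (auto simp: scalar_prod_def Matrix.row_def atLeast0LessThan intro!: sum.cong)

lemma mult_mat_index_sum:
  "A \<in> carrier_mat n k \<Longrightarrow> B \<in> carrier_mat k l \<Longrightarrow> i < n \<Longrightarrow> j < l \<Longrightarrow>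
     (A * B) $$ (i, j) = (\<Sum>h<k. A $$ (i, h) * B $$ (h, j))"
  by (auto simp: scalar_prod_def atLeast0LessThan intro!: sum.cong)

lemma cscalar_prod_sum:
  "v \<in> carrier_vec n \<Longrightarrow> w \<in> carrier_vec n \<Longrightarrow>
     v \<bullet>c w = (\<Sum>i<n. vec_index v i * cnj (vec_index w i))"
  by (auto simp: scalar_prod_def atLeast0LessThan)

lemma adjoint_carrier [simp]: "A \<in> carrier_mat n k \<Longrightarrow> mat_adjoint A \<in> carrier_mat k n"
  by (auto simp: mat_adjoint_def)

lemma adjoint_dim [simp]: "dim_row (mat_adjoint A) = dim_col A" "dim_col (mat_adjoint A) = dim_row A"
  by (auto simp: mat_adjoint_def)

lemma adjoint_index:
  "A \<in> carrier_mat n k \<Longrightarrow> i < k \<Longrightarrow> j < n \<Longrightarrow> mat_adjoint A $$ (i, j) = cnj (A $$ (j, i))"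
  by (auto simp: mat_adjoint_def mat_of_rows_index)

lemma adjoint_adjoint: "A \<in> carrier_mat n k \<Longrightarrow> mat_adjoint (mat_adjoint A) = (A :: complex mat)"
  by (rule eq_matI) (auto simp: adjoint_index[of _ k n] adjoint_index[of _ n k])

lemma adjoint_mult:
  assumes "A \<in> carrier_mat n k" "B \<in> carrier_mat k l"
  shows "mat_adjoint (A * B) = mat_adjoint B * mat_adjoint (A :: complex mat)"
proof (rule eq_matI)
  fix i j assume "i < dim_row (mat_adjoint B * mat_adjoint A)" "j < dim_col (mat_adjoint B * mat_adjoint A)"
  hence ij: "i < l" "j < n" using assms adjoint_carrier[OF assms(1)] adjoint_carrier[OF assms(2)] by auto
  thus "mat_adjoint (A * B) $$ (i, j) = (mat_adjoint B * mat_adjoint A) $$ (i, j)"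
    using assms adjoint_carrier[OF assms(1)] adjoint_carrier[OF assms(2)]
    by (simp add: adjoint_index[of _ n l] mult_mat_index_sum[of _ n k _ l] mult_mat_index_sum[of _ l k _ n]
        adjoint_index[of _ n k] adjoint_index[of _ k l] mult.commute del: index_mult_mat)
qed (use assms adjoint_carrier[OF mult_carrier_mat[OF assms]] adjoint_carrier[OF assms(1)] adjoint_carrier[OF assms(2)] in auto)

lemma cscalar_prod_adjoint:
  fixes A :: "complex mat"
  assumes "A \<in> carrier_mat n k" "v \<in> carrier_vec k" "w \<in> carrier_vec n"
  shows "(A *\<^sub>v v) \<bullet>c w = v \<bullet>c (mat_adjoint A *\<^sub>v w)"
proof -
  have "(A *\<^sub>v v) \<bullet>c w = (\<Sum>i<n. \<Sum>j<k. A $$ (i, j) * vec_index v j * cnj (vec_index w i))"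
    using assms by (simp add: cscalar_prod_sum[of _ n] mult_vec_index_sum[of _ n k] sum_distrib_right
        mult_mat_vec_carrier[of _ n k] del: index_mult_mat_vec)
  also have "\<dots> = (\<Sum>j<k. \<Sum>i<n. A $$ (i, j) * vec_index v j * cnj (vec_index w i))"
    by (rule sum.swap)
  also have "\<dots> = v \<bullet>c (mat_adjoint A *\<^sub>v w)"
    using assms adjoint_carrier[OF assms(1)]
    by (simp add: cscalar_prod_sum[of _ k] mult_vec_index_sum[of _ k n] sum_distrib_left
        mult_mat_vec_carrier[of _ k n] adjoint_index[of _ n k] mult_ac del: index_mult_mat_vec)
  finally show ?thesis .
qed

text \<open>If a product of linear factors \<open>A - r\<close> annihilates a nonzero vector, then applying the factors
one after the other must at some stage turn a nonzero vector into zero, and that vector is an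
eigenvector. The predicate \<open>Q\<close> stands for membership in an \<open>A\<close>-invariant subspace, which the
procedure does not leave. The annihilation is stated through the coefficients of the expanded product.\<close>

lemma linear_factor_eigenvector:
  fixes A :: "complex mat"
  assumes A: "A \<in> carrier_mat n n"
    and Q: "\<And>v. Q v \<Longrightarrow> v \<in> carrier_vec n" "\<And>v r. Q v \<Longrightarrow> Q (A *\<^sub>v v - r \<cdot>\<^sub>v v)"
  shows "Q v \<Longrightarrow> v \<noteq> 0\<^sub>v n \<Longrightarrow>
     (\<forall>i<n. (\<Sum>j\<le>length rs. coeff (\<Prod>r\<leftarrow>rs. [:- r, 1:]) j * vec_index ((A ^\<^sub>m j) *\<^sub>v v) i) = 0) \<Longrightarrow>
     \<exists>w r. Q w \<and> w \<noteq> 0\<^sub>v n \<and> A *\<^sub>v w = r \<cdot>\<^sub>v w"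
proof (induction rs arbitrary: v)
  case Nil
  have "v = 0\<^sub>v n" using Nil Q(1)[OF Nil(1)] A by (intro eq_vecI) auto
  thus ?case using Nil by simp
next
  case (Cons r rs)
  have v: "v \<in> carrier_vec n" by (rule Q(1)[OF Cons.prems(1)])
  have Av: "A *\<^sub>v v \<in> carrier_vec n" using A v by simp
  define w where "w = A *\<^sub>v v - r \<cdot>\<^sub>v v"
  have w: "w \<in> carrier_vec n" using A v by (simp add: w_def)
  show ?case
  proof (cases "w = 0\<^sub>v n")
    case True
    have "A *\<^sub>v v = r \<cdot>\<^sub>v v"
    proof (rule eq_vecI)
      fix i assume "i < dim_vec (r \<cdot>\<^sub>v v)"
      hence i: "i < n" using v by simp
      have "vec_index w i = 0" using True i by simp
      thus "vec_index (A *\<^sub>v v) i = vec_index (r \<cdot>\<^sub>v v) i"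
        using i v A unfolding w_def by simp
    qed (use A v in auto)
    thus ?thesis using Cons.prems by blast
  next
    case False
    define p where "p = (\<Prod>r\<leftarrow>rs. [:- r, 1:])"
    have "degree p \<le> length rs"
      unfolding p_def by (rule order.trans[OF degree_prod_list_le])
        (simp add: o_def sum_list_triv)
    hence top: "coeff p (Suc (length rs)) = 0" by (intro coeff_eq_0) auto
    have "(\<Sum>j\<le>length rs. coeff p j * vec_index ((A ^\<^sub>m j) *\<^sub>v w) i) = 0" if i: "i < n" for i
    proof -
      define a where "a j = vec_index ((A ^\<^sub>m j) *\<^sub>v v) i" for j
      have pow: "A ^\<^sub>m j \<in> carrier_mat n n" for j using A by (rule pow_carrier_mat)
      have "vec_index ((A ^\<^sub>m j) *\<^sub>v w) i = a (Suc j) - r * a j" for j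
      proof -
        have "(A ^\<^sub>m j) *\<^sub>v w = (A ^\<^sub>m Suc j) *\<^sub>v v - r \<cdot>\<^sub>v ((A ^\<^sub>m j) *\<^sub>v v)"
          unfolding w_def using pow[of j] A v Av
          by (simp add: mult_minus_distrib_mat_vec[of _ n n] mult_mat_vec[of _ n n] assoc_mult_mat_vec[of _ n n _ n])
        thus ?thesis unfolding a_def
          using i carrier_matD[OF pow[of j]] v by (simp del: index_mult_mat_vec pow_mat.simps)
      qed
      hence "(\<Sum>j\<le>length rs. coeff p j * vec_index ((A ^\<^sub>m j) *\<^sub>v w) i) =
          (\<Sum>j\<le>length rs. coeff p j * a (Suc j)) - r * (\<Sum>j\<le>length rs. coeff p j * a j)"
        by (simp add: right_diff_distrib sum_subtractf sum_distrib_left mult_ac)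
      also have "\<dots> = (\<Sum>j\<le>Suc (length rs). coeff ([:- r, 1:] * p) j * a j)"
      proof -
        have c: "coeff ([:- r, 1:] * p) j = (case j of 0 \<Rightarrow> 0 | Suc k \<Rightarrow> coeff p k) - r * coeff p j" for j
          by (simp add: coeff_pCons split: nat.split)
        have "(\<Sum>j\<le>N. coeff ([:- r, 1:] * p) j * a j) =
            (\<Sum>j\<le>N. (case j of 0 \<Rightarrow> 0 | Suc k \<Rightarrow> coeff p k) * a j) -
            r * (\<Sum>j\<le>N. coeff p j * a j)" for N
          unfolding c by (simp add: left_diff_distrib sum_subtractf sum_distrib_left mult.assoc)
        from this[of "Suc (length rs)"] have "(\<Sum>j\<le>Suc (length rs). coeff ([:- r, 1:] * p) j * a j) =
            (\<Sum>j\<le>Suc (length rs). (case j of 0 \<Rightarrow> 0 | Suc k \<Rightarrow> coeff p k) * a j) -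
            r * (\<Sum>j\<le>Suc (length rs). coeff p j * a j)" .
        also have "(\<Sum>j\<le>Suc (length rs). (case j of 0 \<Rightarrow> 0 | Suc k \<Rightarrow> coeff p k) * a j) =
            (\<Sum>j\<le>length rs. coeff p j * a (Suc j))"
          by (subst sum.atMost_Suc_shift) simp
        also have "(\<Sum>j\<le>Suc (length rs). coeff p j * a j) = (\<Sum>j\<le>length rs. coeff p j * a j)"
          by (simp add: top)
        finally show ?thesis by simp
      qed
      also have "\<dots> = 0" using Cons.prems(3) i by (simp add: p_def a_def)
      finally show ?thesis .
    qed
    with Cons.IH[of w] False Q(2)[OF Cons.prems(1), of r] show ?thesis
      unfolding w_def p_def by blast
  qed
qed

text \<open>The \<open>n + 1\<close> vectors \<open>A\<^sup>j v\<close> are dependent, which yields a nonzero polynomial that annihilates \<open>v\<close>; over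
the complex numbers it splits into linear factors.\<close>

lemma invariant_subspace_eigenvector:
  fixes A :: "complex mat"
  assumes A: "A \<in> carrier_mat n n"
    and Q: "\<And>v. Q v \<Longrightarrow> v \<in> carrier_vec n" "\<And>v r. Q v \<Longrightarrow> Q (A *\<^sub>v v - r \<cdot>\<^sub>v v)"
    and v: "Q v" "v \<noteq> 0\<^sub>v n"
  shows "\<exists>w r. Q w \<and> w \<noteq> 0\<^sub>v n \<and> A *\<^sub>v w = r \<cdot>\<^sub>v w"
proof -
  have vc: "v \<in> carrier_vec n" by (rule Q(1)[OF v(1)])
  have pow: "A ^\<^sub>m j \<in> carrier_mat n n" for j using A by (rule pow_carrier_mat)
  \<comment> \<open>The vectors \<open>A\<^sup>j v\<close> as columns, padded by a zero row to a square, hence singular, matrix.\<close>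
  define B where "B = Matrix.mat (Suc n) (Suc n)
      (\<lambda>(i, j). if i = n then 0 else vec_index ((A ^\<^sub>m j) *\<^sub>v v) i)"
  have B: "B \<in> carrier_mat (Suc n) (Suc n)" by (simp add: B_def)
  have "det B = 0"
  proof -
    have "B = mat\<^sub>r (Suc n) (Suc n) (\<lambda>i. if i = n then 0\<^sub>v (Suc n) else Matrix.row B i)"
      by (rule eq_matI) (auto simp: B_def)
    also have "det \<dots> = 0" using B by (intro det_row_0) auto
    finally show ?thesis .
  qed
  then obtain c where c: "c \<in> carrier_vec (Suc n)" "c \<noteq> 0\<^sub>v (Suc n)" "B *\<^sub>v c = 0\<^sub>v (Suc n)"
    using det_0_iff_vec_prod_zero[OF B] by blast
  define p where "p = (\<Sum>j\<le>n. monom (vec_index c j) j)"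
  have coeff_p: "coeff p j = (if j \<le> n then vec_index c j else 0)" for j
    by (auto simp: p_def coeff_sum)
  have "p \<noteq> 0"
  proof
    assume "p = 0"
    hence "vec_index c j = 0" if "j \<le> n" for j using coeff_p[of j] that by simp
    hence "c = 0\<^sub>v (Suc n)" using c(1) by (intro eq_vecI) auto
    thus False using c(2) by simp
  qed
  obtain rs where rs: "Polynomial.smult (lead_coeff p) (\<Prod>r\<leftarrow>rs. [:- r, 1:]) = p" "length rs = degree p"
    using fundamental_theorem_algebra_factorized[of p] by blast
  have deg: "degree p \<le> n" by (intro degree_le) (auto simp: coeff_p)
  have "(\<Sum>j\<le>length rs. coeff (\<Prod>r\<leftarrow>rs. [:- r, 1:]) j * vec_index ((A ^\<^sub>m j) *\<^sub>v v) i) = 0"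
    if i: "i < n" for i
  proof -
    let ?a = "\<lambda>j. vec_index ((A ^\<^sub>m j) *\<^sub>v v) i"
    have "0 = vec_index (B *\<^sub>v c) i" using c(3) i by simp
    also have "\<dots> = (\<Sum>j<Suc n. B $$ (i, j) * vec_index c j)"
      using B c(1) i by (intro mult_vec_index_sum[of _ "Suc n"]) auto
    also have "\<dots> = (\<Sum>j\<le>n. coeff p j * ?a j)"
      unfolding lessThan_Suc_atMost using i by (intro sum.cong) (auto simp: B_def coeff_p)
    also have "\<dots> = (\<Sum>j\<le>length rs. coeff p j * ?a j)"
      using deg by (intro sum.mono_neutral_right) (auto simp: rs(2) coeff_eq_0)
    also have "\<dots> = lead_coeff p * (\<Sum>j\<le>length rs. coeff (\<Prod>r\<leftarrow>rs. [:- r, 1:]) j * ?a j)"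
      by (subst rs(1)[symmetric]) (simp add: sum_distrib_left mult_ac)
    finally show ?thesis using \<open>p \<noteq> 0\<close> by simp
  qed
  thus ?thesis using linear_factor_eigenvector[OF A Q v, of rs] by blast
qed

lemma vec_norm2_square: "v \<in> carrier_vec n \<Longrightarrow> v \<bullet>c v = of_real ((vec_norm2 v)\<^sup>2)"
  unfolding vec_norm2_def
  by (simp add: cscalar_prod_sum[of _ n] L2_set_def sum_nonneg complex_norm_square[symmetric])

lemma vec_norm2_nonneg [simp]: "vec_norm2 v \<ge> 0"
  by (simp add: vec_norm2_def L2_set_def sum_nonneg)

lemma vec_norm2_eqI:
  assumes "v \<in> carrier_vec n" "w \<in> carrier_vec k" "v \<bullet>c v = w \<bullet>c w"
  shows "vec_norm2 v = vec_norm2 w"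
proof -
  have "(vec_norm2 v)\<^sup>2 = (vec_norm2 w)\<^sup>2"
    using assms(3) unfolding vec_norm2_square[OF assms(1)] vec_norm2_square[OF assms(2)] of_real_eq_iff .
  thus ?thesis by (simp add: power2_eq_iff_nonneg)
qed

lemma vec_norm2_pos: "v \<in> carrier_vec n \<Longrightarrow> v \<noteq> 0\<^sub>v n \<Longrightarrow> vec_norm2 v > 0"
  using vec_norm2_square[of v n] conjugate_square_eq_0_vec[of v n] vec_norm2_nonneg[of v]
  by (cases "vec_norm2 v = 0") (auto simp: less_le)

lemma vec_norm2_add_le:
  assumes "v \<in> carrier_vec n" "w \<in> carrier_vec n"
  shows "vec_norm2 (v + w) \<le> vec_norm2 v + vec_norm2 w"
proof -
  have "vec_norm2 (v + w) \<le> L2_set (\<lambda>i. cmod (vec_index v i) + cmod (vec_index w i)) {..<n}"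
    unfolding vec_norm2_def using assms by (auto intro!: L2_set_mono norm_triangle_ineq)
  also have "\<dots> \<le> vec_norm2 v + vec_norm2 w"
    unfolding vec_norm2_def using assms L2_set_triangle_ineq by auto
  finally show ?thesis .
qed

lemma vec_norm2_isometry:
  assumes V: "V \<in> carrier_mat n k" "mat_adjoint V * V = 1\<^sub>m k" and x: "x \<in> carrier_vec k"
  shows "vec_norm2 (V *\<^sub>v x) = vec_norm2 x"
proof (rule vec_norm2_eqI)
  have "(V *\<^sub>v x) \<bullet>c (V *\<^sub>v x) = x \<bullet>c (mat_adjoint V *\<^sub>v (V *\<^sub>v x))"
    using V x by (intro cscalar_prod_adjoint) auto
  also have "mat_adjoint V *\<^sub>v (V *\<^sub>v x) = x"
    using V x adjoint_carrier[OF V(1)] by (subst assoc_mult_mat_vec[symmetric]) auto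
  finally show "(V *\<^sub>v x) \<bullet>c (V *\<^sub>v x) = x \<bullet>c x" .
  show "V *\<^sub>v x \<in> carrier_vec n" using V x by simp
qed (use x in auto)

text \<open>Orthonormal eigenvectors are added one at a time: the orthogonal complement of the present ones is
nonzero for dimension reasons and \<open>A\<close>-invariant since \<open>A\<close> is Hermitian.\<close>

lemma hermitian_orthonormal_eigenvectors:
  fixes A :: "complex mat"
  assumes A: "A \<in> carrier_mat n n" "mat_adjoint A = A"
  shows "k \<le> n \<Longrightarrow> \<exists>u r. (\<forall>i<k. u i \<in> carrier_vec n \<and> A *\<^sub>v u i = r i \<cdot>\<^sub>v u i) \<and>
     (\<forall>i<k. \<forall>j<k. u i \<bullet>c u j = (if i = j then 1 else 0))"
proof (induction k)
  case 0
  thus ?case by simp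
next
  case (Suc k)
  hence "\<exists>u r. (\<forall>i<k. u i \<in> carrier_vec n \<and> A *\<^sub>v u i = r i \<cdot>\<^sub>v u i) \<and>
     (\<forall>i<k. \<forall>j<k. u i \<bullet>c u j = (if i = j then 1 else 0))" by simp
  then obtain u r where "(\<forall>i<k. u i \<in> carrier_vec n \<and> A *\<^sub>v u i = r i \<cdot>\<^sub>v u i) \<and>
     (\<forall>i<k. \<forall>j<k. u i \<bullet>c u j = (if i = j then 1 else 0))" by blast
  hence u: "\<And>i. i < k \<Longrightarrow> u i \<in> carrier_vec n"
      "\<And>i. i < k \<Longrightarrow> A *\<^sub>v u i = r i \<cdot>\<^sub>v u i"
      "\<And>i j. i < k \<Longrightarrow> j < k \<Longrightarrow> u i \<bullet>c u j = (if i = j then 1 else 0)" by blast+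
  have k: "k < n" using Suc.prems by simp
  define Q where "Q v \<longleftrightarrow> v \<in> carrier_vec n \<and> (\<forall>i<k. v \<bullet>c u i = 0)" for v
  have Q_step: "Q (A *\<^sub>v v - c \<cdot>\<^sub>v v)" if v: "Q v" for v c
  proof -
    have vc: "v \<in> carrier_vec n" "A *\<^sub>v v \<in> carrier_vec n" using v A by (auto simp: Q_def)
    have "(A *\<^sub>v v - c \<cdot>\<^sub>v v) \<bullet>c u i = 0" if i: "i < k" for i
    proof -
      have "(A *\<^sub>v v) \<bullet>c u i = v \<bullet>c (A *\<^sub>v u i)"
        using cscalar_prod_adjoint[OF A(1) vc(1) u(1)[OF i]] A(2) by simp
      also have "\<dots> = cnj (r i) * (v \<bullet>c u i)"
        using u(1,2)[OF i] vc by (simp add: conjugate_smult_vec)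
      also have "v \<bullet>c u i = 0" using v i by (simp add: Q_def)
      finally have "(A *\<^sub>v v) \<bullet>c u i = 0" by simp
      thus ?thesis using \<open>v \<bullet>c u i = 0\<close> u(1)[OF i] vc
        by (simp add: minus_scalar_prod_distrib[of _ n])
    qed
    thus ?thesis using vc by (simp add: Q_def)
  qed
  obtain v where v: "Q v" "v \<noteq> 0\<^sub>v n"
  proof -
    \<comment> \<open>Rows from \<open>k\<close> on vanish, so \<open>B\<close> is singular; its kernel is the orthogonal complement.\<close>
    define B where "B = mat\<^sub>r n n (\<lambda>i. if i = k then 0\<^sub>v n else if i < k then conjugate (u i) else 0\<^sub>v n)"
    have B: "B \<in> carrier_mat n n" by (simp add: B_def)
    have "det B = 0" unfolding B_def using k u(1) by (intro det_row_0) auto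
    then obtain v where v: "v \<in> carrier_vec n" "v \<noteq> 0\<^sub>v n" "B *\<^sub>v v = 0\<^sub>v n"
      using det_0_iff_vec_prod_zero[OF B] by blast
    have "v \<bullet>c u i = 0" if i: "i < k" for i
    proof -
      have "0 = vec_index (B *\<^sub>v v) i" using v(3) i k by simp
      also have "\<dots> = (\<Sum>j<n. B $$ (i, j) * vec_index v j)"
        using B v(1) i k by (intro mult_vec_index_sum[of _ n n]) auto
      also have "\<dots> = v \<bullet>c u i"
        using i k u(1)[OF i] v(1) unfolding cscalar_prod_sum[OF v(1) u(1)[OF i]]
        by (intro sum.cong) (auto simp: B_def)
      finally show ?thesis by simp
    qed
    thus ?thesis using v by (intro that[of v]) (auto simp: Q_def)
  qed
  obtain w c where w: "Q w" "w \<noteq> 0\<^sub>v n" "A *\<^sub>v w = c \<cdot>\<^sub>v w"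
    using invariant_subspace_eigenvector[OF A(1), of Q v] Q_step v by (auto simp: Q_def)
  have wc: "w \<in> carrier_vec n" using w by (simp add: Q_def)
  define d where "d = complex_of_real (1 / vec_norm2 w)"
  define e where "e = d \<cdot>\<^sub>v w"
  have nw: "vec_norm2 w > 0" by (rule vec_norm2_pos[OF wc w(2)])
  have ec: "e \<in> carrier_vec n" using wc by (simp add: e_def)
  have Ae: "A *\<^sub>v e = c \<cdot>\<^sub>v e"
    using wc A(1) by (simp add: e_def mult_mat_vec[of _ n n] w(3) smult_smult_assoc mult.commute)
  have ee: "e \<bullet>c e = 1"
  proof -
    have "e \<bullet>c e = d * cnj d * (w \<bullet>c w)"
      using wc by (simp add: e_def conjugate_smult_vec)
    also have "\<dots> = of_real (1 / vec_norm2 w * (1 / vec_norm2 w) * (vec_norm2 w)\<^sup>2)"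
      unfolding vec_norm2_square[OF wc] by (simp add: d_def)
    also have "1 / vec_norm2 w * (1 / vec_norm2 w) * (vec_norm2 w)\<^sup>2 = 1"
      using nw by (simp add: power2_eq_square)
    finally show ?thesis by simp
  qed
  have eu: "e \<bullet>c u i = 0" if "i < k" for i
    using w(1) wc u(1)[OF that] that by (simp add: e_def Q_def)
  have ue: "u i \<bullet>c e = 0" if "i < k" for i
  proof -
    have "u i \<bullet>c e = cnj (e \<bullet>c u i)"
      using ec u(1)[OF that] by (simp add: cscalar_prod_sum[of _ n] mult.commute)
    thus ?thesis using eu[OF that] by simp
  qed
  show ?case
  proof (intro exI conjI allI impI)
    fix i assume "i < Suc k"
    thus "(u(k := e)) i \<in> carrier_vec n" "A *\<^sub>v (u(k := e)) i = (r(k := c)) i \<cdot>\<^sub>v (u(k := e)) i"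
      using u(1,2)[of i] ec Ae by (auto simp: less_Suc_eq)
  next
    fix i j assume "i < Suc k" "j < Suc k"
    thus "(u(k := e)) i \<bullet>c (u(k := e)) j = (if i = j then 1 else 0)"
      using u(3)[of i j] ee eu ue by (auto simp: less_Suc_eq)
  qed
qed

text \<open>The matrix \<open>f (A)\<close> when \<open>W\<close> holds an orthonormal eigenbasis of \<open>A\<close> and \<open>l\<close> the real eigenvalues.\<close>

definition spectral_fun :: "complex mat \<Rightarrow> (nat \<Rightarrow> real) \<Rightarrow> (complex \<Rightarrow> complex) \<Rightarrow> complex mat" where
  "spectral_fun W l f = W * mat_diag (dim_row W) (\<lambda>i. f (of_real (l i))) * mat_adjoint W"

definition unitary_mat :: "nat \<Rightarrow> complex mat \<Rightarrow> bool" where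
  "unitary_mat n W \<longleftrightarrow> W \<in> carrier_mat n n \<and> mat_adjoint W * W = 1\<^sub>m n \<and> W * mat_adjoint W = 1\<^sub>m n"

lemma herm_nonpos_spectral:
  assumes "herm_nonpos n A"
  obtains W l where "unitary_mat n W" "\<And>i. i < n \<Longrightarrow> l i \<le> 0" "A = spectral_fun W l (\<lambda>z. z)"
proof -
  have A: "A \<in> carrier_mat n n" "mat_adjoint A = A"
    and neg: "\<And>v. v \<in> carrier_vec n \<Longrightarrow> Re ((A *\<^sub>v v) \<bullet>c v) \<le> 0"
    using assms by (auto simp: herm_nonpos_def)
  obtain u r where "(\<forall>i<n. u i \<in> carrier_vec n \<and> A *\<^sub>v u i = r i \<cdot>\<^sub>v u i) \<and>
     (\<forall>i<n. \<forall>j<n. u i \<bullet>c u j = (if i = j then 1 else 0))"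
    using hermitian_orthonormal_eigenvectors[OF A, of n] by blast
  hence u: "\<And>i. i < n \<Longrightarrow> u i \<in> carrier_vec n"
      "\<And>i. i < n \<Longrightarrow> A *\<^sub>v u i = r i \<cdot>\<^sub>v u i"
      "\<And>i j. i < n \<Longrightarrow> j < n \<Longrightarrow> u i \<bullet>c u j = (if i = j then 1 else 0)" by blast+
  have r1: "(A *\<^sub>v u i) \<bullet>c u i = r i" if "i < n" for i
    using u(1,2)[OF that] u(3)[OF that that] by simp
  have r2: "(A *\<^sub>v u i) \<bullet>c u i = cnj (r i)" if "i < n" for i
    using u(1,2)[OF that] u(3)[OF that that] cscalar_prod_adjoint[OF A(1), of "u i" "u i"] A(2)
    by (simp add: conjugate_smult_vec)
  define l where "l i = Re (r i)" for i
  have rl: "r i = of_real (l i)" if "i < n" for i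
    using r1[OF that] r2[OF that] by (auto simp: l_def complex_eq_iff)
  have l: "l i \<le> 0" if "i < n" for i
    using neg[OF u(1)[OF that]] r1[OF that] by (simp add: l_def)
  define W where "W = Matrix.mat n n (\<lambda>(i, j). vec_index (u j) i)"
  have W: "W \<in> carrier_mat n n" by (simp add: W_def)
  have W': "mat_adjoint W \<in> carrier_mat n n" using W by simp
  have inv: "mat_adjoint W * W = 1\<^sub>m n"
  proof (rule eq_matI)
    fix i j assume ij: "i < dim_row (1\<^sub>m n)" "j < dim_col (1\<^sub>m n)"
    hence "(mat_adjoint W * W) $$ (i, j) = (\<Sum>h<n. cnj (vec_index (u i) h) * vec_index (u j) h)"
      using W W' by (simp add: mult_mat_index_sum[of _ n n _ n] adjoint_index[of _ n n] W_def del: index_mult_mat)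
    also have "\<dots> = u j \<bullet>c u i" using ij by (simp add: cscalar_prod_sum[of _ n] u mult.commute)
    finally show "(mat_adjoint W * W) $$ (i, j) = 1\<^sub>m n $$ (i, j)"
      using ij u(3)[of j i] by (auto simp: one_mat_def)
  qed (use W in auto)
  have uni: "unitary_mat n W"
    unfolding unitary_mat_def using W inv mat_mult_left_right_inverse[OF W' W inv] by simp
  have AW: "A * W = W * mat_diag n (\<lambda>i. of_real (l i))"
  proof (rule eq_matI)
    fix i j assume "i < dim_row (W * mat_diag n (\<lambda>i. complex_of_real (l i)))"
      "j < dim_col (W * mat_diag n (\<lambda>i. complex_of_real (l i)))"
    hence ij: "i < n" "j < n" using W by (auto simp: mat_diag_def)
    have "(A * W) $$ (i, j) = (\<Sum>h<n. A $$ (i, h) * vec_index (u j) h)"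
      using A W ij by (simp add: mult_mat_index_sum[of _ n n _ n] W_def del: index_mult_mat)
    also have "\<dots> = vec_index (A *\<^sub>v u j) i" using A u(1) ij by (subst mult_vec_index_sum[of _ n n]) auto
    also have "\<dots> = r j * vec_index (u j) i" using u(1,2)[OF ij(2)] ij by simp
    also have "\<dots> = (W * mat_diag n (\<lambda>i. of_real (l i))) $$ (i, j)"
      using ij W by (subst mat_diag_mult_right[of _ n]) (auto simp: W_def rl)
    finally show "(A * W) $$ (i, j) = (W * mat_diag n (\<lambda>i. of_real (l i))) $$ (i, j)" .
  qed (use A W in \<open>auto simp: mat_diag_def\<close>)
  have "A = A * (W * mat_adjoint W)" using uni A by (simp add: unitary_mat_def)
  also have "\<dots> = A * W * mat_adjoint W" using A W W' by (subst assoc_mult_mat) auto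
  finally have "A = spectral_fun W l (\<lambda>z. z)" unfolding AW spectral_fun_def using W by simp
  with that uni l show ?thesis by blast
qed

context
  fixes n W assumes W: "unitary_mat n W"
begin

lemma unitary_carrier: "W \<in> carrier_mat n n" "mat_adjoint W \<in> carrier_mat n n" "dim_row W = n"
  using W by (auto simp: unitary_mat_def)

lemma spectral_fun_carrier [simp]: "spectral_fun W l f \<in> carrier_mat n n"
  unfolding spectral_fun_def unitary_carrier(3)
  by (intro mult_carrier_mat[of _ n n] unitary_carrier mat_diag_dim)

lemma spectral_fun_dim [simp]: "dim_row (spectral_fun W l f) = n" "dim_col (spectral_fun W l f) = n"
  using carrier_matD[OF spectral_fun_carrier] by simp_all

lemma spectral_fun_index:
  assumes "i < n" "j < n"
  shows "spectral_fun W l f $$ (i, j) = (\<Sum>h<n. W $$ (i, h) * f (of_real (l h)) * cnj (W $$ (j, h)))"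
proof -
  have "spectral_fun W l f $$ (i, j) = (\<Sum>h<n. (W * mat_diag n (\<lambda>i. f (of_real (l i)))) $$ (i, h) * mat_adjoint W $$ (h, j))"
    unfolding spectral_fun_def unitary_carrier(3) using unitary_carrier assms
    by (intro mult_mat_index_sum[of _ n n _ n] mult_carrier_mat[of _ n n] mat_diag_dim)
  also have "\<dots> = (\<Sum>h<n. W $$ (i, h) * f (of_real (l h)) * cnj (W $$ (j, h)))"
    using unitary_carrier assms by (subst mat_diag_mult_right[of _ n]) (auto simp: adjoint_index[of _ n n])
  finally show ?thesis .
qed

lemma spectral_fun_one: "spectral_fun W l (\<lambda>_. 1) = 1\<^sub>m n"
  using W unitary_carrier by (simp add: spectral_fun_def unitary_mat_def)

lemma spectral_fun_mult: "spectral_fun W l f * spectral_fun W l g = spectral_fun W l (\<lambda>z. f z * g z)"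
proof -
  define D :: "(complex \<Rightarrow> complex) \<Rightarrow> complex mat" where "D f = mat_diag n (\<lambda>i. f (complex_of_real (l i)))" for f
  have D: "D f \<in> carrier_mat n n" for f by (simp add: D_def)
  note [simp] = unitary_carrier D
  have WD: "W * D f \<in> carrier_mat n n" for f by (rule mult_carrier_mat[of _ _ n]) simp_all
  have "spectral_fun W l f * spectral_fun W l g = W * D f * mat_adjoint W * (W * D g * mat_adjoint W)"
    by (simp add: spectral_fun_def D_def)
  also have "\<dots> = W * D f * (mat_adjoint W * (W * D g * mat_adjoint W))"
    using WD by (intro assoc_mult_mat[of _ n n _ n _ n] mult_carrier_mat[of _ n n _ n]) simp_all
  also have "mat_adjoint W * (W * D g * mat_adjoint W) = mat_adjoint W * (W * D g) * mat_adjoint W"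
    using WD by (intro assoc_mult_mat[of _ n n _ n _ n, symmetric]) simp_all
  also have "mat_adjoint W * (W * D g) = mat_adjoint W * W * D g"
    by (intro assoc_mult_mat[of _ n n _ n _ n, symmetric]) simp_all
  also have "mat_adjoint W * W = 1\<^sub>m n" using W by (simp add: unitary_mat_def)
  also have "1\<^sub>m n * D g = D g" by (rule left_mult_one_mat[of _ n n]) simp
  also have "W * D f * (D g * mat_adjoint W) = W * D f * D g * mat_adjoint W"
    using WD by (intro assoc_mult_mat[of _ n n _ n _ n, symmetric]) simp_all
  also have "W * D f * D g = W * (D f * D g)"
    by (intro assoc_mult_mat[of _ n n _ n _ n]) simp_all
  also have "D f * D g = D (\<lambda>z. f z * g z)" by (simp add: D_def)
  finally show ?thesis by (simp add: spectral_fun_def D_def)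
qed

lemma spectral_fun_add: "spectral_fun W l f + spectral_fun W l g = spectral_fun W l (\<lambda>z. f z + g z)"
  by (rule eq_matI) (simp_all add: spectral_fun_index distrib_left distrib_right sum.distrib)

lemma spectral_fun_smult: "c \<cdot>\<^sub>m spectral_fun W l f = spectral_fun W l (\<lambda>z. c * f z)"
  by (rule eq_matI) (simp_all add: spectral_fun_index sum_distrib_left mult_ac)

lemma spectral_fun_pow: "spectral_fun W l f ^\<^sub>m k = spectral_fun W l (\<lambda>z. f z ^ k)"
  by (induction k) (simp_all add: spectral_fun_one spectral_fun_mult mult.commute)

lemma spectral_fun_cong:
  assumes "\<And>i. i < n \<Longrightarrow> f (of_real (l i)) = g (of_real (l i))"
  shows "spectral_fun W l f = spectral_fun W l g"
  by (rule eq_matI) (simp_all add: spectral_fun_index assms)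

lemma mat_exp_spectral_fun: "mat_exp (spectral_fun W l f) = spectral_fun W l (\<lambda>z. exp (f z))"
proof (rule eq_matI)
  fix i j assume "i < dim_row (spectral_fun W l (\<lambda>z. exp (f z)))" "j < dim_col (spectral_fun W l (\<lambda>z. exp (f z)))"
  hence ij: "i < n" "j < n" by simp_all
  have "(\<lambda>k. \<Sum>h<n. W $$ (i, h) * (f (of_real (l h)) ^ k /\<^sub>R fact k) * cnj (W $$ (j, h))) sums
        (\<Sum>h<n. W $$ (i, h) * exp (f (of_real (l h))) * cnj (W $$ (j, h)))"
    by (intro sums_sum sums_mult sums_mult2 exp_converges)
  also have "(\<lambda>k. \<Sum>h<n. W $$ (i, h) * (f (of_real (l h)) ^ k /\<^sub>R fact k) * cnj (W $$ (j, h))) =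
      (\<lambda>k. (spectral_fun W l f ^\<^sub>m k) $$ (i, j) / fact k)"
    using ij by (simp add: fun_eq_iff spectral_fun_pow spectral_fun_index scaleR_conv_of_real sum_distrib_left divide_inverse mult_ac)
  finally have "(\<Sum>k. (spectral_fun W l f ^\<^sub>m k) $$ (i, j) / fact k) = spectral_fun W l (\<lambda>z. exp (f z)) $$ (i, j)"
    using ij by (simp add: sums_iff spectral_fun_index)
  thus "mat_exp (spectral_fun W l f) $$ (i, j) = spectral_fun W l (\<lambda>z. exp (f z)) $$ (i, j)"
    using ij by (simp add: mat_exp_def)
qed (simp_all add: mat_exp_def)

text \<open>Unitary invariance of the norm reduces the bound to a diagonal matrix.\<close>

lemma norm_spectral_fun_le:
  assumes v: "v \<in> carrier_vec n" and f: "\<And>i. i < n \<Longrightarrow> cmod (f (of_real (l i))) \<le> B" and B: "B \<ge> 0"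
  shows "vec_norm2 (spectral_fun W l f *\<^sub>v v) \<le> B * vec_norm2 v"
proof -
  define D where "D = mat_diag n (\<lambda>i. f (complex_of_real (l i)))"
  have D: "D \<in> carrier_mat n n" by (simp add: D_def)
  define x where "x = mat_adjoint W *\<^sub>v v"
  have x: "x \<in> carrier_vec n" using unitary_carrier v unfolding x_def by (intro mult_mat_vec_carrier[of _ n n]) auto
  have nx: "vec_norm2 x = vec_norm2 v"
    unfolding x_def using W unitary_carrier v
    by (intro vec_norm2_isometry[of _ n n]) (auto simp: unitary_mat_def adjoint_adjoint[of _ n n])
  have Dx: "D *\<^sub>v x \<in> carrier_vec n" using D x by simp
  have "spectral_fun W l f *\<^sub>v v = W *\<^sub>v (D *\<^sub>v x)"
    unfolding spectral_fun_def unitary_carrier(3) D_def[symmetric] x_def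
  proof -
    have "W * D * mat_adjoint W *\<^sub>v v = W * D *\<^sub>v (mat_adjoint W *\<^sub>v v)"
      using unitary_carrier D v by (intro assoc_mult_mat_vec[of _ n n _ n] mult_carrier_mat[of _ n n]) auto
    also have "\<dots> = W *\<^sub>v (D *\<^sub>v (mat_adjoint W *\<^sub>v v))"
      using unitary_carrier D x by (intro assoc_mult_mat_vec[of _ n n _ n]) (auto simp: x_def)
    finally show "W * D * mat_adjoint W *\<^sub>v v = W *\<^sub>v (D *\<^sub>v (mat_adjoint W *\<^sub>v v))" .
  qed
  hence "vec_norm2 (spectral_fun W l f *\<^sub>v v) = vec_norm2 (D *\<^sub>v x)"
    using W Dx by (simp add: vec_norm2_isometry[of _ n n] unitary_mat_def)
  also have "\<dots> = L2_set (\<lambda>i. cmod (f (of_real (l i)) * vec_index x i)) {..<n}"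
  proof -
    have "vec_index (D *\<^sub>v x) i = f (of_real (l i)) * vec_index x i" if i: "i < n" for i
    proof -
      have "vec_index (D *\<^sub>v x) i = (\<Sum>j<n. D $$ (i, j) * vec_index x j)"
        using D x i by (rule mult_vec_index_sum)
      also have "\<dots> = (\<Sum>j<n. if j = i then f (of_real (l i)) * vec_index x i else 0)"
        using i by (intro sum.cong) (auto simp: D_def mat_diag_def)
      finally show ?thesis using i by simp
    qed
    thus ?thesis using Dx D unfolding vec_norm2_def by (intro L2_set_cong) auto
  qed
  also have "\<dots> \<le> L2_set (\<lambda>i. B * cmod (vec_index x i)) {..<n}"
    using f by (intro L2_set_mono) (auto simp: norm_mult mult_right_mono)
  also have "\<dots> = B * vec_norm2 x"
    using B x by (simp add: L2_set_right_distrib vec_norm2_def)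
  finally show ?thesis by (simp add: nx)
qed

end

section \<open>Galerkin approximation from the shift-and-invert space\<close>

lemma spectral_fun_const:
  assumes W: "unitary_mat n W"
  shows "spectral_fun W l (\<lambda>_. c) = c \<cdot>\<^sub>m 1\<^sub>m n"
  using spectral_fun_smult[OF W, of c l "\<lambda>_. 1"] by (simp add: spectral_fun_one[OF W])

lemma poly_pCons_fun: "poly (pCons a p) = (\<lambda>z. a + poly p z * z)"
  by (simp add: fun_eq_iff mult.commute)

lemma shift_inv_spectral_fun:
  assumes W: "unitary_mat n W" and l: "\<And>i. i < n \<Longrightarrow> l i \<le> 0" and q: "q > 0"
  shows "shift_inv q (spectral_fun W l (\<lambda>z. z)) = spectral_fun W l (\<lambda>z. 1 / (of_real q - z))"
proof -
  note [simp] = spectral_fun_carrier[OF W] spectral_fun_dim[OF W]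
  define B where "B = spectral_fun W l (\<lambda>z. of_real q - z)"
  define R where "R = spectral_fun W l (\<lambda>z. 1 / (of_real q - z))"
  have BR [simp]: "B \<in> carrier_mat n n" "R \<in> carrier_mat n n" by (simp_all add: B_def R_def)
  have nz: "complex_of_real q - of_real (l i) \<noteq> 0" if "i < n" for i
    using l[OF that] q by (simp flip: of_real_diff)
  have B_eq: "B = of_real q \<cdot>\<^sub>m 1\<^sub>m n - spectral_fun W l (\<lambda>z. z)"
  proof -
    show ?thesis unfolding B_def spectral_fun_const[OF W, where l = l, symmetric]
      by (intro eq_matI) (simp_all add: spectral_fun_index[OF W] right_diff_distrib left_diff_distrib sum_subtractf)
  qed
  have inv: "B * R = 1\<^sub>m n" "R * B = 1\<^sub>m n"
  proof -
    have "spectral_fun W l (\<lambda>z. (of_real q - z) * (1 / (of_real q - z))) = spectral_fun W l (\<lambda>_. 1)"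
      "spectral_fun W l (\<lambda>z. (1 / (of_real q - z)) * (of_real q - z)) = spectral_fun W l (\<lambda>_. 1)"
      by (intro spectral_fun_cong[OF W]; use nz in simp)+
    thus "B * R = 1\<^sub>m n" "R * B = 1\<^sub>m n"
      by (simp_all only: B_def R_def spectral_fun_mult[OF W] spectral_fun_one[OF W])
  qed
  have "mat_inverse B \<noteq> None"
  proof
    assume "mat_inverse B = None"
    hence "B \<notin> Units (ring_mat TYPE(complex) n ())" using mat_inverse(1)[of B n] by simp
    moreover have "B \<in> Units (ring_mat TYPE(complex) n ())"
      using inv by (auto simp: Units_def ring_mat_def intro!: bexI[of _ R])
    ultimately show False by contradiction
  qed
  then obtain C where C: "mat_inverse B = Some C" by auto
  hence C': "C * B = 1\<^sub>m n" "C \<in> carrier_mat n n" using mat_inverse(2)[of B n C] by simp_all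
  have "C = C * (B * R)" using C' inv by simp
  also have "\<dots> = C * B * R" using C' by (intro assoc_mult_mat[symmetric, of _ n n _ n _ n]) simp_all
  also have "\<dots> = R" using C' by (simp add: left_mult_one_mat[of _ n n])
  finally show ?thesis using C unfolding shift_inv_def by (simp add: R_def B_eq)
qed

lemma column_space_projection:
  assumes V: "V \<in> carrier_mat n k" "mat_adjoint V * V = 1\<^sub>m k"
    and v: "v \<in> LinearCombinations.module.span class_ring (module_vec TYPE(complex) n) (set (cols V))"
  shows "v \<in> carrier_vec n" "V *\<^sub>v (mat_adjoint V *\<^sub>v v) = v"
proof -
  interpret vec_space "TYPE(complex)" n .
  have "v \<in> col_space V" using v by (simp add: col_space_def)
  then obtain x where x: "x \<in> carrier_vec k" "V *\<^sub>v x = v"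
    using col_space_eq[OF V(1)] V(1) by auto
  have "mat_adjoint V *\<^sub>v (V *\<^sub>v x) = x"
    using V x by (subst assoc_mult_mat_vec[symmetric, of _ k n _ k]) auto
  thus "V *\<^sub>v (mat_adjoint V *\<^sub>v v) = v" using x by auto
  show "v \<in> carrier_vec n" using x V by auto
qed

text \<open>Exactness of the Galerkin compression on a Krylov space: as long as the powers \<open>A\<^sup>j w\<close> are fixed by
the projection \<open>V V\<^sup>*\<close>, one may insert it after each application of \<open>A\<close>, which turns \<open>A\<close> into \<open>V\<^sup>* A V\<close>.
The induction along \<open>p (z) = a + z p' (z)\<close> replaces \<open>w\<close> by \<open>A w\<close> and \<open>d\<close> by \<open>d - 1\<close>.\<close>

lemma galerkin_poly_exact:
  assumes A: "A \<in> carrier_mat n n" and V: "V \<in> carrier_mat n k" "mat_adjoint V * V = 1\<^sub>m k"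
    and W: "unitary_mat n W" "A = spectral_fun W l (\<lambda>z. z)"
    and U: "unitary_mat k U" "mat_adjoint V * A * V = spectral_fun U \<mu> (\<lambda>z. z)"
  shows "degree p \<le> d \<Longrightarrow> w \<in> carrier_vec n \<Longrightarrow>
     (\<And>j. j \<le> d \<Longrightarrow> V *\<^sub>v (mat_adjoint V *\<^sub>v (spectral_fun W l (\<lambda>z. z ^ j) *\<^sub>v w)) = spectral_fun W l (\<lambda>z. z ^ j) *\<^sub>v w) \<Longrightarrow>
     spectral_fun W l (poly p) *\<^sub>v w = V *\<^sub>v (spectral_fun U \<mu> (poly p) *\<^sub>v (mat_adjoint V *\<^sub>v w))"
proof (induction p arbitrary: d w)
  case 0
  have z: "spectral_fun W l (\<lambda>_. 0) = 0\<^sub>m n n" "spectral_fun U \<mu> (\<lambda>_. 0) = 0\<^sub>m k k"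
    by (rule eq_matI; simp add: spectral_fun_index[OF W(1)] spectral_fun_dim[OF W(1)] spectral_fun_index[OF U(1)] spectral_fun_dim[OF U(1)])+
  have x: "mat_adjoint V *\<^sub>v w \<in> carrier_vec k" using V 0 by (intro mult_mat_vec_carrier[of _ k n]) auto
  have "V *\<^sub>v 0\<^sub>v k = 0\<^sub>v n" using V by auto
  moreover have "0\<^sub>m n n *\<^sub>v w = 0\<^sub>v n" "0\<^sub>m k k *\<^sub>v (mat_adjoint V *\<^sub>v w) = 0\<^sub>v k"
    using 0(2) x by auto
  ultimately show ?case by (simp add: z)
next
  case (pCons a p)
  note [simp] = spectral_fun_carrier[OF W(1)] spectral_fun_dim[OF W(1)] spectral_fun_carrier[OF U(1)] spectral_fun_dim[OF U(1)]
  have V': "mat_adjoint V \<in> carrier_mat k n" using V by simp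
  define x where "x = mat_adjoint V *\<^sub>v w"
  have w: "w \<in> carrier_vec n" by fact
  have x: "x \<in> carrier_vec k" using V' w unfolding x_def by (intro mult_mat_vec_carrier[of _ k n]) auto
  have Aw: "A *\<^sub>v w \<in> carrier_vec n" using A w by simp
  have inv: "V *\<^sub>v x = w"
    using pCons.prems(3)[of 0] w by (simp add: x_def spectral_fun_one[OF W(1)])
  have split: "spectral_fun Z h (poly (pCons a p)) *\<^sub>v u = a \<cdot>\<^sub>v u + spectral_fun Z h (poly p) *\<^sub>v (spectral_fun Z h (\<lambda>z. z) *\<^sub>v u)"
    if Z: "unitary_mat r Z" and u: "u \<in> carrier_vec r" for Z h u r
  proof -
    note [simp] = spectral_fun_carrier[OF Z] spectral_fun_dim[OF Z]
    have "spectral_fun Z h (poly (pCons a p)) = a \<cdot>\<^sub>m 1\<^sub>m r + spectral_fun Z h (poly p) * spectral_fun Z h (\<lambda>z. z)"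
      by (simp only: poly_pCons_fun spectral_fun_const[OF Z, where l = h, symmetric] spectral_fun_mult[OF Z] spectral_fun_add[OF Z])
    also have "\<dots> *\<^sub>v u = (a \<cdot>\<^sub>m 1\<^sub>m r) *\<^sub>v u + (spectral_fun Z h (poly p) * spectral_fun Z h (\<lambda>z. z)) *\<^sub>v u"
      using u by (intro add_mult_distrib_mat_vec[of _ r r]) (auto intro!: mult_carrier_mat[of _ r r])
    also have "(a \<cdot>\<^sub>m 1\<^sub>m r) *\<^sub>v u = a \<cdot>\<^sub>v u"
      using u by (intro eq_vecI) auto
    also have "(spectral_fun Z h (poly p) * spectral_fun Z h (\<lambda>z. z)) *\<^sub>v u = spectral_fun Z h (poly p) *\<^sub>v (spectral_fun Z h (\<lambda>z. z) *\<^sub>v u)"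
      using u by (intro assoc_mult_mat_vec[of _ r r _ r]) auto
    finally show ?thesis .
  qed
  show ?case
  proof (cases "p = 0")
    case True
    have "spectral_fun W l (poly (pCons a p)) *\<^sub>v w = a \<cdot>\<^sub>v w" "spectral_fun U \<mu> (poly (pCons a p)) *\<^sub>v x = a \<cdot>\<^sub>v x"
    proof -
      have "spectral_fun Z h (poly (pCons a p)) *\<^sub>v u = a \<cdot>\<^sub>v u"
        if Z: "unitary_mat r Z" and u: "u \<in> carrier_vec r" for Z h u r
      proof -
        have "spectral_fun Z h (poly (pCons a p)) = a \<cdot>\<^sub>m 1\<^sub>m r"
          by (simp add: True poly_pCons_fun spectral_fun_const[OF Z])
        thus ?thesis using u by (intro eq_vecI) auto
      qed
      thus "spectral_fun W l (poly (pCons a p)) *\<^sub>v w = a \<cdot>\<^sub>v w" "spectral_fun U \<mu> (poly (pCons a p)) *\<^sub>v x = a \<cdot>\<^sub>v x"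
        using W(1) U(1) w x by blast+
    qed
    thus ?thesis using mult_mat_vec[OF V(1) x, of a] inv by (simp only: x_def[symmetric])
  next
    case False
    hence "d \<ge> 1" "degree p \<le> d - 1" using pCons.prems(1) by auto
    have "spectral_fun W l (poly p) *\<^sub>v (A *\<^sub>v w) = V *\<^sub>v (spectral_fun U \<mu> (poly p) *\<^sub>v (mat_adjoint V *\<^sub>v (A *\<^sub>v w)))"
    proof (rule pCons.IH[OF \<open>degree p \<le> d - 1\<close> Aw])
      fix j assume j: "j \<le> d - 1"
      have "spectral_fun W l (\<lambda>z. z ^ j) *\<^sub>v (A *\<^sub>v w) = (spectral_fun W l (\<lambda>z. z ^ j) * A) *\<^sub>v w"
        using A w by (intro assoc_mult_mat_vec[symmetric, of _ n n _ n]) auto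
      also have "spectral_fun W l (\<lambda>z. z ^ j) * A = spectral_fun W l (\<lambda>z. z ^ Suc j)"
        unfolding W(2) spectral_fun_mult[OF W(1)] by (simp add: mult.commute)
      finally show "V *\<^sub>v (mat_adjoint V *\<^sub>v (spectral_fun W l (\<lambda>z. z ^ j) *\<^sub>v (A *\<^sub>v w))) = spectral_fun W l (\<lambda>z. z ^ j) *\<^sub>v (A *\<^sub>v w)"
        using pCons.prems(3)[of "Suc j"] j \<open>d \<ge> 1\<close> by simp
    qed
    also have "mat_adjoint V *\<^sub>v (A *\<^sub>v w) = (mat_adjoint V * A * V) *\<^sub>v x"
    proof -
      have "(mat_adjoint V * A * V) *\<^sub>v x = (mat_adjoint V * A) *\<^sub>v (V *\<^sub>v x)"
        using V V' A x by (intro assoc_mult_mat_vec[of _ k n _ k] mult_carrier_mat[of _ k n]) auto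
      also have "\<dots> = mat_adjoint V *\<^sub>v (A *\<^sub>v w)"
        unfolding inv using V' A w by (intro assoc_mult_mat_vec[of _ k n _ n]) auto
      finally show ?thesis ..
    qed
    finally have IH: "spectral_fun W l (poly p) *\<^sub>v (A *\<^sub>v w) = V *\<^sub>v (spectral_fun U \<mu> (poly p) *\<^sub>v (spectral_fun U \<mu> (\<lambda>z. z) *\<^sub>v x))"
      unfolding U(2) .
    have cx: "spectral_fun U \<mu> (\<lambda>z. z) *\<^sub>v x \<in> carrier_vec k"
      using x by (intro mult_mat_vec_carrier[of _ k k]) auto
    from spectral_fun_carrier[OF U(1)] this
    have cx: "spectral_fun U \<mu> (poly p) *\<^sub>v (spectral_fun U \<mu> (\<lambda>z. z) *\<^sub>v x) \<in> carrier_vec k"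
      by (rule mult_mat_vec_carrier)
    have "spectral_fun W l (poly (pCons a p)) *\<^sub>v w = a \<cdot>\<^sub>v w + spectral_fun W l (poly p) *\<^sub>v (A *\<^sub>v w)"
      using split[OF W(1) w, of l] by (simp only: W(2))
    also have "\<dots> = V *\<^sub>v (a \<cdot>\<^sub>v x) + V *\<^sub>v (spectral_fun U \<mu> (poly p) *\<^sub>v (spectral_fun U \<mu> (\<lambda>z. z) *\<^sub>v x))"
      unfolding IH using mult_mat_vec[OF V(1) x, of a] inv by simp
    also have "\<dots> = V *\<^sub>v (a \<cdot>\<^sub>v x + spectral_fun U \<mu> (poly p) *\<^sub>v (spectral_fun U \<mu> (\<lambda>z. z) *\<^sub>v x))"
      using x cx V by (intro mult_add_distrib_mat_vec[symmetric, of _ n k]) auto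
    also have "\<dots> = V *\<^sub>v (spectral_fun U \<mu> (poly (pCons a p)) *\<^sub>v x)"
      using split[OF U(1) x, of \<mu>] by (simp only:)
    finally show ?thesis by (simp only: x_def)
  qed
qed

text \<open>Every \<open>r = P / (q - z)\<^sup>m\<close> is reproduced exactly: the shift-and-invert space is the polynomial Krylov
space of \<open>c = (q I - A)\<^sup>-\<^sup>m b\<close>, so \<open>P (A) c\<close> is reproduced, and applying the same to \<open>(q - z)\<^sup>m\<close> shows that
\<open>V\<^sup>* c = (q I - V\<^sup>* A V)\<^sup>-\<^sup>m V\<^sup>* b\<close>. What remains of the error is \<open>e\<^sup>t\<^sup>z - r\<close> evaluated at \<open>A\<close> and at the
compression \<open>V\<^sup>* A V\<close>, which is again Hermitian and nonpositive: hence the factor 2.\<close>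

lemma SI_error_le_uniform:
  assumes q: "q > 0" and SI: "SI_setup m q n A b V" and r: "r \<in> rat_space m q"
    and B: "\<And>z. z \<le> 0 \<Longrightarrow> cmod (exp (complex_of_real (t * z)) - r (complex_of_real z)) \<le> B"
  shows "SI_error t A b V \<le> 2 * vec_norm2 b * B"
proof -
  have A: "herm_nonpos n A" "A \<in> carrier_mat n n" "mat_adjoint A = A" and b: "b \<in> carrier_vec n"
    and onb: "onb_matrix n (SI_space m A b q) V"
    using SI by (auto simp: SI_setup_def herm_nonpos_def)
  define k where "k = dim_col V"
  have V: "V \<in> carrier_mat n k" using onb by (auto simp: onb_matrix_def k_def)
  have V': "mat_adjoint V \<in> carrier_mat k n" using V by simp
  have VV: "mat_adjoint V * V = 1\<^sub>m k"
  proof (rule eq_matI)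
    fix i j assume ij: "i < dim_row (1\<^sub>m k)" "j < dim_col (1\<^sub>m k)"
    hence "(mat_adjoint V * V) $$ (i, j) = (\<Sum>h<n. cnj (V $$ (h, i)) * V $$ (h, j))"
      using V V' by (simp add: mult_mat_index_sum[of _ k n _ k] adjoint_index[of _ n k] del: index_mult_mat)
    also have "\<dots> = col V j \<bullet>c col V i"
      using ij V by (subst cscalar_prod_sum[of _ n]) (auto simp: mult.commute)
    finally show "(mat_adjoint V * V) $$ (i, j) = 1\<^sub>m k $$ (i, j)"
      using onb ij by (auto simp: onb_matrix_def k_def)
  qed (use V in auto)
  define H where "H = mat_adjoint V * A * V"
  have "herm_nonpos k H"
    unfolding herm_nonpos_def
  proof (intro conjI ballI)
    have VA: "mat_adjoint V * A \<in> carrier_mat k n" using V' A(2) by (rule mult_carrier_mat)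
    show Hc: "H \<in> carrier_mat k k" unfolding H_def using VA V by (rule mult_carrier_mat)
    have "mat_adjoint H = mat_adjoint V * (A * V)"
      unfolding H_def adjoint_mult[OF VA V] adjoint_mult[OF V' A(2)] A(3) adjoint_adjoint[OF V] ..
    also have "\<dots> = H" unfolding H_def by (rule assoc_mult_mat[OF V' A(2) V, symmetric])
    finally show "mat_adjoint H = H" .
    fix x :: "complex Matrix.vec" assume x: "x \<in> carrier_vec k"
    have Vx: "V *\<^sub>v x \<in> carrier_vec n" using V x by (rule mult_mat_vec_carrier)
    have AVx: "A *\<^sub>v (V *\<^sub>v x) \<in> carrier_vec n" using A(2) Vx by (rule mult_mat_vec_carrier)
    have "H *\<^sub>v x = mat_adjoint V *\<^sub>v (A *\<^sub>v (V *\<^sub>v x))"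
      unfolding H_def assoc_mult_mat_vec[OF VA V x] assoc_mult_mat_vec[OF V' A(2) Vx] ..
    hence "(H *\<^sub>v x) \<bullet>c x = (A *\<^sub>v (V *\<^sub>v x)) \<bullet>c (V *\<^sub>v x)"
      using cscalar_prod_adjoint[OF V' AVx x] by (simp add: adjoint_adjoint[OF V])
    thus "Re ((H *\<^sub>v x) \<bullet>c x) \<le> 0" using A(1) Vx by (simp add: herm_nonpos_def)
  qed
  then obtain U \<mu> where U: "unitary_mat k U" "\<And>i. i < k \<Longrightarrow> \<mu> i \<le> 0" "H = spectral_fun U \<mu> (\<lambda>z. z)"
    by (rule herm_nonpos_spectral) blast
  from A(1) obtain W l where W: "unitary_mat n W" "\<And>i. i < n \<Longrightarrow> l i \<le> 0" "A = spectral_fun W l (\<lambda>z. z)"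
    by (rule herm_nonpos_spectral) blast
  have nz: "complex_of_real q - of_real s \<noteq> 0" if "s \<le> 0" for s
    using that q by (simp flip: of_real_diff)
  note [simp] = spectral_fun_carrier[OF W(1)] spectral_fun_dim[OF W(1)] spectral_fun_carrier[OF U(1)] spectral_fun_dim[OF U(1)]
  have fb: "spectral_fun W l f *\<^sub>v b \<in> carrier_vec n" for f
    by (rule mult_mat_vec_carrier[OF spectral_fun_carrier[OF W(1)] b])

  \<comment> \<open>\<open>N f\<close>: the vector \<open>f (A) b\<close> lies in the approximation space.\<close>
  define N where "N f \<longleftrightarrow> V *\<^sub>v (mat_adjoint V *\<^sub>v (spectral_fun W l f *\<^sub>v b)) = spectral_fun W l f *\<^sub>v b" for f
  have N_gen: "N (\<lambda>z. (1 / (of_real q - z)) ^ i)" if i: "i \<le> m" for i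
  proof -
    interpret vec_space "TYPE(complex)" n .
    have X: "shift_inv q A = spectral_fun W l (\<lambda>z. 1 / (of_real q - z))"
      unfolding W(3) by (rule shift_inv_spectral_fun[OF W(1,2) q])
    let ?S = "(\<lambda>j. (shift_inv q A ^\<^sub>m j) *\<^sub>v b) ` {..m}"
    have S: "?S \<subseteq> carrier_vec n" unfolding X spectral_fun_pow[OF W(1)] using fb by auto
    have "SI_space m A b q = span ?S" unfolding SI_space_def using b by simp
    moreover have "spectral_fun W l (\<lambda>z. (1 / (of_real q - z)) ^ i) *\<^sub>v b \<in> ?S"
      unfolding X spectral_fun_pow[OF W(1)] using i by auto
    hence "spectral_fun W l (\<lambda>z. (1 / (of_real q - z)) ^ i) *\<^sub>v b \<in> span ?S"
      using in_own_span[OF S] by blast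
    ultimately have "spectral_fun W l (\<lambda>z. (1 / (of_real q - z)) ^ i) *\<^sub>v b \<in> span (set (cols V))"
      using onb by (simp add: onb_matrix_def)
    thus ?thesis unfolding N_def by (rule column_space_projection(2)[OF V VV])
  qed
  have N_add: "N (\<lambda>z. f z + g z)" if "N f" "N g" for f g
  proof -
    have eq: "spectral_fun W l (\<lambda>z. f z + g z) *\<^sub>v b = spectral_fun W l f *\<^sub>v b + spectral_fun W l g *\<^sub>v b"
      unfolding spectral_fun_add[OF W(1), symmetric] using b by (intro add_mult_distrib_mat_vec[of _ n n]) auto
    have Vf: "mat_adjoint V *\<^sub>v (spectral_fun W l f *\<^sub>v b) \<in> carrier_vec k" for f
      using V' fb by (rule mult_mat_vec_carrier)
    show ?thesis using that unfolding N_def eq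
      by (simp add: mult_add_distrib_mat_vec[OF V' fb fb] mult_add_distrib_mat_vec[OF V Vf Vf])
  qed
  have N_smult: "N (\<lambda>z. c * f z)" if "N f" for f c
  proof -
    have eq: "spectral_fun W l (\<lambda>z. c * f z) *\<^sub>v b = c \<cdot>\<^sub>v (spectral_fun W l f *\<^sub>v b)"
      unfolding spectral_fun_smult[OF W(1), symmetric] using b by (intro eq_vecI) auto
    have Vf: "mat_adjoint V *\<^sub>v (spectral_fun W l f *\<^sub>v b) \<in> carrier_vec k" for f
      using V' fb by (rule mult_mat_vec_carrier)
    show ?thesis using that unfolding N_def eq
      by (simp add: mult_mat_vec[OF V' fb] mult_mat_vec[OF V Vf])
  qed
  have N_sum: "N (\<lambda>z. \<Sum>i\<in>I. f i z)" if "finite I" "\<And>i. i \<in> I \<Longrightarrow> N (f i)" for I :: "nat set" and f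
    using that
  proof (induction rule: finite_induct)
    case empty
    from N_smult[OF N_gen[of 0], of 0] show ?case by simp
  next
    case (insert i I)
    thus ?case using N_add[of "f i"] by simp
  qed
  define c where "c = spectral_fun W l (\<lambda>z. (1 / (of_real q - z)) ^ m) *\<^sub>v b"
  have c: "c \<in> carrier_vec n" unfolding c_def by (rule fb)
  have spectral_fun_c: "spectral_fun W l f *\<^sub>v c = spectral_fun W l (\<lambda>z. f z * (1 / (of_real q - z)) ^ m) *\<^sub>v b" for f
    unfolding c_def spectral_fun_mult[OF W(1), symmetric] using b
    by (intro assoc_mult_mat_vec[symmetric, of _ n n _ n]) auto
  have krylov: "V *\<^sub>v (mat_adjoint V *\<^sub>v (spectral_fun W l (\<lambda>z. z ^ j) *\<^sub>v c)) = spectral_fun W l (\<lambda>z. z ^ j) *\<^sub>v c"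
    if j: "j \<le> m" for j
  proof -
    \<comment> \<open>\<open>z\<^sup>j / (q - z)\<^sup>m\<close> in powers of \<open>1 / (q - z)\<close>, by expanding \<open>z\<^sup>j = (q - (q - z))\<^sup>j\<close>.\<close>
    define g :: "complex \<Rightarrow> complex" where "g z = (\<Sum>i\<in>{..j}. (of_nat (j choose i) * (- 1) ^ i * of_real q ^ (j - i)) *
        (1 / (of_real q - z)) ^ (m - i))" for z
    have "N g" unfolding g_def using j by (intro N_sum N_smult N_gen) auto
    moreover have "spectral_fun W l (\<lambda>z. z ^ j * (1 / (of_real q - z)) ^ m) = spectral_fun W l g"
    proof (rule spectral_fun_cong[OF W(1)])
      fix h assume "h < n"
      define d where "d = complex_of_real q - of_real (l h)"
      have d: "d \<noteq> 0" unfolding d_def using W(2)[OF \<open>h < n\<close>] by (rule nz)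
      have "of_real (l h) ^ j * (1 / d) ^ m = (- d + of_real q) ^ j * (1 / d) ^ m" by (simp add: d_def)
      also have "\<dots> = (\<Sum>i\<le>j. of_nat (j choose i) * (- d) ^ i * of_real q ^ (j - i) * (1 / d) ^ m)"
        by (simp only: binomial_ring sum_distrib_right)
      also have "\<dots> = (\<Sum>i\<le>j. (of_nat (j choose i) * (- 1) ^ i * of_real q ^ (j - i)) * (1 / d) ^ (m - i))"
      proof (rule sum.cong[OF refl])
        fix i assume "i \<in> {..j}"
        hence "i \<le> m" using j by simp
        hence "(1 / d) ^ m = (1 / d) ^ i * (1 / d) ^ (m - i)" by (simp flip: power_add)
        moreover have "(- d) ^ i * (1 / d) ^ i = (- 1) ^ i"
          using d by (simp flip: power_mult_distrib)
        ultimately show "of_nat (j choose i) * (- d) ^ i * of_real q ^ (j - i) * (1 / d) ^ m =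
            (of_nat (j choose i) * (- 1) ^ i * of_real q ^ (j - i)) * (1 / d) ^ (m - i)"
          by (simp add: mult_ac)
      qed
      finally show "of_real (l h) ^ j * (1 / (of_real q - of_real (l h))) ^ m = g (of_real (l h))"
        by (simp add: g_def d_def)
    qed
    ultimately show ?thesis unfolding spectral_fun_c N_def by simp
  qed
  have exact: "spectral_fun W l (poly p) *\<^sub>v c = V *\<^sub>v (spectral_fun U \<mu> (poly p) *\<^sub>v (mat_adjoint V *\<^sub>v c))"
    if "degree p \<le> m" for p
    by (rule galerkin_poly_exact[OF A(2) V VV W(1,3) U(1) _ that c krylov])
       (use U(3) in \<open>simp_all add: H_def\<close>)
  have Vc: "mat_adjoint V *\<^sub>v c \<in> carrier_vec k" using V' c by (rule mult_mat_vec_carrier)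
  define x where "x = mat_adjoint V *\<^sub>v b"
  have x: "x \<in> carrier_vec k" unfolding x_def using V' b by (rule mult_mat_vec_carrier)
  have fx: "spectral_fun U \<mu> f *\<^sub>v x \<in> carrier_vec k" for f
    by (rule mult_mat_vec_carrier[OF spectral_fun_carrier[OF U(1)] x])
  have Vx: "V *\<^sub>v x = b"
    using N_gen[of 0] b by (simp add: N_def x_def spectral_fun_one[OF W(1)])
  have norm_x: "vec_norm2 x = vec_norm2 b"
    using vec_norm2_isometry[OF V VV x] by (simp add: Vx)
  have x_eq: "x = spectral_fun U \<mu> (\<lambda>z. (of_real q - z) ^ m) *\<^sub>v (mat_adjoint V *\<^sub>v c)"
  proof -
    define p where "p = [:complex_of_real q, - 1:] ^ m"
    have p: "poly p = (\<lambda>z. (of_real q - z) ^ m)" by (simp add: p_def fun_eq_iff)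
    have "degree p \<le> m" unfolding p_def by (rule order.trans[OF degree_power_le]) simp
    have "spectral_fun W l (\<lambda>z. (of_real q - z) ^ m * (1 / (of_real q - z)) ^ m) = spectral_fun W l (\<lambda>_. 1)"
      by (rule spectral_fun_cong[OF W(1)]) (use nz W(2) in \<open>simp flip: power_mult_distrib\<close>)
    hence "b = spectral_fun W l (poly p) *\<^sub>v c"
      using b unfolding spectral_fun_c p by (simp add: spectral_fun_one[OF W(1)])
    also have "\<dots> = V *\<^sub>v (spectral_fun U \<mu> (poly p) *\<^sub>v (mat_adjoint V *\<^sub>v c))"
      by (rule exact) fact
    finally have "x = mat_adjoint V *\<^sub>v (V *\<^sub>v (spectral_fun U \<mu> (poly p) *\<^sub>v (mat_adjoint V *\<^sub>v c)))"
      by (simp only: x_def)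
    also have "\<dots> = (mat_adjoint V * V) *\<^sub>v (spectral_fun U \<mu> (poly p) *\<^sub>v (mat_adjoint V *\<^sub>v c))"
      by (rule assoc_mult_mat_vec[OF V' V mult_mat_vec_carrier[OF spectral_fun_carrier[OF U(1)] Vc], symmetric])
    also have "\<dots> = spectral_fun U \<mu> (poly p) *\<^sub>v (mat_adjoint V *\<^sub>v c)"
      unfolding VV by (rule one_mult_mat_vec[OF mult_mat_vec_carrier[OF spectral_fun_carrier[OF U(1)] Vc]])
    finally show ?thesis unfolding p .
  qed
  from r obtain P where P: "degree P \<le> m" "r = (\<lambda>z. poly P z / (of_real q - z) ^ m)"
    by (auto simp: rat_space_def)
  have r_exact: "spectral_fun W l r *\<^sub>v b = V *\<^sub>v (spectral_fun U \<mu> r *\<^sub>v x)"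
  proof -
    have "spectral_fun W l r *\<^sub>v b = spectral_fun W l (poly P) *\<^sub>v c"
      unfolding spectral_fun_c P(2) by (simp add: power_one_over)
    also have "\<dots> = V *\<^sub>v (spectral_fun U \<mu> (poly P) *\<^sub>v (mat_adjoint V *\<^sub>v c))"
      by (rule exact) fact
    also have "spectral_fun U \<mu> (poly P) = spectral_fun U \<mu> (\<lambda>z. r z * (of_real q - z) ^ m)"
      by (rule spectral_fun_cong[OF U(1)]) (use nz U(2) in \<open>simp add: P(2)\<close>)
    also have "\<dots> *\<^sub>v (mat_adjoint V *\<^sub>v c) = spectral_fun U \<mu> r *\<^sub>v x"
      unfolding x_eq spectral_fun_mult[OF U(1), symmetric] using Vc
      by (intro assoc_mult_mat_vec[of _ k k _ k]) auto
    finally show ?thesis .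
  qed
  define e :: "complex \<Rightarrow> complex" where "e z = exp (of_real t * z)" for z
  have expA: "mat_exp (complex_of_real t \<cdot>\<^sub>m A) = spectral_fun W l e"
    unfolding W(3) spectral_fun_smult[OF W(1)] mat_exp_spectral_fun[OF W(1)] e_def ..
  have expH: "mat_exp (complex_of_real t \<cdot>\<^sub>m H) = spectral_fun U \<mu> e"
    unfolding U(3) spectral_fun_smult[OF U(1)] mat_exp_spectral_fun[OF U(1)] e_def ..
  have B': "cmod (e (of_real z) - r (of_real z)) \<le> B" if "z \<le> 0" for z
    using B[OF that] by (simp add: e_def)
  have B0: "B \<ge> 0" using order.trans[OF norm_ge_zero B'[of 0]] by simp
  define d where "d z = e z - r z" for z
  have split: "spectral_fun Z h e *\<^sub>v u = spectral_fun Z h r *\<^sub>v u + spectral_fun Z h d *\<^sub>v u"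
    if Z: "unitary_mat s Z" and u: "u \<in> carrier_vec s" for Z h u s
  proof -
    have "spectral_fun Z h e = spectral_fun Z h r + spectral_fun Z h d"
      by (simp add: spectral_fun_add[OF Z] d_def)
    thus ?thesis using u by (simp add: add_mult_distrib_mat_vec[OF spectral_fun_carrier[OF Z] spectral_fun_carrier[OF Z]])
  qed
  have "mat_exp (complex_of_real t \<cdot>\<^sub>m A) *\<^sub>v b - galerkin_exp t A b V =
      spectral_fun W l e *\<^sub>v b - V *\<^sub>v (spectral_fun U \<mu> e *\<^sub>v x)"
    unfolding galerkin_exp_def H_def[symmetric] expA expH x_def ..
  also have "\<dots> = spectral_fun W l d *\<^sub>v b + V *\<^sub>v ((- 1) \<cdot>\<^sub>v (spectral_fun U \<mu> d *\<^sub>v x))"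
  proof -
    have Vf: "V *\<^sub>v (spectral_fun U \<mu> f *\<^sub>v x) \<in> carrier_vec n" for f
      using V fx by (rule mult_mat_vec_carrier)
    show ?thesis
      unfolding split[OF W(1) b] split[OF U(1) x] mult_add_distrib_mat_vec[OF V fx fx] r_exact
        mult_mat_vec[OF V fx]
      using carrier_vecD[OF fb[of d]] carrier_vecD[OF Vf[of r]] carrier_vecD[OF Vf[of d]]
      by (intro eq_vecI) (simp_all del: index_mult_mat_vec)
  qed
  finally have "SI_error t A b V \<le> vec_norm2 (spectral_fun W l d *\<^sub>v b) + vec_norm2 (V *\<^sub>v ((- 1) \<cdot>\<^sub>v (spectral_fun U \<mu> d *\<^sub>v x)))"
    unfolding SI_error_def using V fx[of d]
    by (simp only:) (intro vec_norm2_add_le[OF fb] mult_mat_vec_carrier[of _ n k] smult_carrier_vec[THEN iffD2])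
  also have "vec_norm2 (V *\<^sub>v ((- 1) \<cdot>\<^sub>v (spectral_fun U \<mu> d *\<^sub>v x))) = vec_norm2 ((- 1) \<cdot>\<^sub>v (spectral_fun U \<mu> d *\<^sub>v x))"
    using fx by (intro vec_norm2_isometry[OF V VV]) auto
  also have "\<dots> = vec_norm2 (spectral_fun U \<mu> d *\<^sub>v x)"
    using carrier_vecD[OF fx[of d]] unfolding vec_norm2_def
    by (intro L2_set_cong) (simp_all del: index_mult_mat_vec)
  also have "vec_norm2 (spectral_fun W l d *\<^sub>v b) + vec_norm2 (spectral_fun U \<mu> d *\<^sub>v x) \<le> B * vec_norm2 b + B * vec_norm2 x"
    using B' W(2) U(2)
    by (intro add_mono norm_spectral_fun_le[OF W(1) b _ B0] norm_spectral_fun_le[OF U(1) x _ B0]) (auto simp: d_def)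
  finally show ?thesis by (simp add: norm_x mult_ac)
qed

lemma SI_error_le_rat_err:
  assumes q: "q > 0" and t: "t > 0" and SI: "SI_setup m q n A b V"
  shows "SI_error t A b V \<le> 2 * vec_norm2 b * rat_err m t q"
proof -
  have b: "vec_norm2 b > 0" using SI by (intro vec_norm2_pos[of _ n]) (auto simp: SI_setup_def)
  have "SI_error t A b V / (2 * vec_norm2 b) \<le> rat_err m t q"
    unfolding rat_err_def
  proof (rule cINF_greatest)
    have "(\<lambda>z. poly 0 z / (of_real q - z) ^ m) \<in> rat_space m q"
      unfolding rat_space_def by (intro CollectI exI[of _ 0]) auto
    thus "rat_space m q \<noteq> {}" by blast
  next
    fix r assume r: "r \<in> rat_space m q"
    let ?E = "\<lambda>z. cmod (exp (complex_of_real (t * z)) - r (complex_of_real z))"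
    have "?E z \<le> (SUP z\<in>{..0}. ?E z)" if "z \<le> 0" for z
      using that t by (intro cSUP_upper rat_space_bounded[OF r q]) auto
    hence "SI_error t A b V \<le> 2 * vec_norm2 b * (SUP z\<in>{..0}. ?E z)"
      by (rule SI_error_le_uniform[OF q SI r])
    thus "SI_error t A b V / (2 * vec_norm2 b) \<le> (SUP z\<in>{..0}. ?E z)"
      using b by (subst pos_divide_le_eq) (simp, simp only: mult_ac)
  qed
  thus ?thesis using b by (simp add: divide_le_eq mult_ac)
qed

section \<open>Convergence rates\<close>

lemma limsup_root_le:
  fixes f :: "nat \<Rightarrow> real"
  assumes H: "H \<ge> 0" and C: "C > 0" and f: "\<And>m. m \<ge> 1 \<Longrightarrow> f m \<le> C * H ^ m"
  shows "limsup (\<lambda>m. ereal (root m (f m))) \<le> ereal H"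
proof -
  have "(\<lambda>m. root m C * H) \<longlonglongrightarrow> 1 * H"
    by (intro tendsto_intros LIMSEQ_root_const C)
  hence lim: "(\<lambda>m. ereal (root m C * H)) \<longlonglongrightarrow> ereal H" by simp
  have "limsup (\<lambda>m. ereal (root m (f m))) \<le> limsup (\<lambda>m. ereal (root m C * H))"
  proof (rule Limsup_mono)
    show "\<forall>\<^sub>F m in sequentially. ereal (root m (f m)) \<le> ereal (root m C * H)"
      using eventually_ge_at_top[of "1::nat"]
    proof eventually_elim
      case (elim m)
      hence "root m (f m) \<le> root m (C * H ^ m)" using f by (intro real_root_le_mono) auto
      also have "\<dots> = root m C * H" using elim H by (simp add: real_root_mult real_root_power_cancel)
      finally show ?case by simp
    qed
  qed
  also have "\<dots> = ereal H" by (rule lim_imp_Limsup[OF _ lim]) simp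
  finally show ?thesis .
qed

text \<open>Both asymptotic statements are instances: the constant depends on \<open>\<alpha>\<close> and \<open>t\<close> but not on the matrices.\<close>

lemma SI_error_saddle_bound:
  fixes \<alpha> t :: real
  assumes \<alpha>: "0 < \<alpha>" "\<alpha> < 3 * sqrt 3 / 2" and t: "t > 0"
  shows "\<exists>C>0. \<forall>m n A b V. m \<ge> 1 \<longrightarrow> SI_setup m (\<alpha> * real m / t) n A b V \<longrightarrow>
     SI_error t A b V \<le> C * vec_norm2 b * real m powr (- 1 / 2) * H_e \<alpha> ^ m"
proof -
  from rat_err_saddle_bound[OF \<alpha> t] obtain C where C: "C > 0"
    "\<And>m. m \<ge> 1 \<Longrightarrow> rat_err m t (\<alpha> * real m / t) \<le> C * real m powr (- 1 / 2) * H_e \<alpha> ^ m" by blast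
  have "SI_error t A b V \<le> 2 * C * vec_norm2 b * real m powr (- 1 / 2) * H_e \<alpha> ^ m"
    if m: "m \<ge> 1" and SI: "SI_setup m (\<alpha> * real m / t) n A b V" for m n A b V
  proof -
    have "\<alpha> * real m / t > 0" using \<alpha> t m by simp
    hence "SI_error t A b V \<le> 2 * vec_norm2 b * rat_err m t (\<alpha> * real m / t)"
      using t SI by (rule SI_error_le_rat_err)
    also have "\<dots> \<le> 2 * vec_norm2 b * (C * real m powr (- 1 / 2) * H_e \<alpha> ^ m)"
      using C(2)[OF m] by (intro mult_left_mono) auto
    finally show ?thesis by (simp only: mult_ac)
  qed
  thus ?thesis using C(1) by (intro exI[of _ "2 * C"]) auto
qed

theorem proposition7p2:
  fixes t :: real
  assumes "t > 0"
  shows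
    "(\<forall>(m::nat) (q::real) n A b V. q > 0 \<longrightarrow> SI_setup m q n A b V \<longrightarrow>
        SI_error t A b V \<le> 2 * vec_norm2 b * rat_err m t q)
   \<and> (\<forall>\<alpha>::real. 0 < \<alpha> \<longrightarrow> \<alpha> < 3 * sqrt 3 / 2 \<longrightarrow>
        (\<forall>(n :: nat \<Rightarrow> nat) A b V.
          (\<forall>m\<ge>1. SI_setup m (\<alpha> * real m / t) (n m) (A m) (b m) (V m)) \<longrightarrow>
          limsup (\<lambda>m. ereal (root m (SI_error t (A m) (b m) (V m) / vec_norm2 (b m))))
            \<le> ereal (H_e \<alpha>)))
   \<and> (\<exists>C>0. \<forall>(n :: nat \<Rightarrow> nat) A b V.
          (\<forall>m\<ge>1. SI_setup m (1 / sqrt 2 * real m / t) (n m) (A m) (b m) (V m)) \<longrightarrow>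
          (\<forall>\<^sub>F m in sequentially. SI_error t (A m) (b m) (V m)
             \<le> C * vec_norm2 (b m) * real m powr (- 1 / 2) * (sqrt 2 - 1) ^ m))"
proof (intro conjI allI impI)
  fix m q n A b V
  assume "q > 0" "SI_setup m q n A b V"
  thus "SI_error t A b V \<le> 2 * vec_norm2 b * rat_err m t q"
    using assms by (intro SI_error_le_rat_err)
next
  fix \<alpha> :: real and n :: "nat \<Rightarrow> nat" and A b V
  assume \<alpha>: "0 < \<alpha>" "\<alpha> < 3 * sqrt 3 / 2"
    and SI: "\<forall>m\<ge>1. SI_setup m (\<alpha> * real m / t) (n m) (A m) (b m) (V m)"
  from SI_error_saddle_bound[OF \<alpha> assms] obtain C where C: "C > 0"
    "\<And>m n A b V. m \<ge> 1 \<Longrightarrow> SI_setup m (\<alpha> * real m / t) n A b V \<Longrightarrow>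
       SI_error t A b V \<le> C * vec_norm2 b * real m powr (- 1 / 2) * H_e \<alpha> ^ m" by blast
  show "limsup (\<lambda>m. ereal (root m (SI_error t (A m) (b m) (V m) / vec_norm2 (b m)))) \<le> ereal (H_e \<alpha>)"
  proof (rule limsup_root_le[OF less_imp_le[OF H_e_pos[OF \<alpha>]] C(1)])
    fix m :: nat assume m: "m \<ge> 1"
    have b: "vec_norm2 (b m) > 0"
      using SI m by (intro vec_norm2_pos[of _ "n m"]) (auto simp: SI_setup_def)
    have "real m powr (- 1 / 2) \<le> real m powr 0" using m by (intro powr_mono) auto
    hence "C * vec_norm2 (b m) * real m powr (- 1 / 2) * H_e \<alpha> ^ m \<le> C * vec_norm2 (b m) * 1 * H_e \<alpha> ^ m"
      using C(1) H_e_pos[OF \<alpha>] m by (intro mult_right_mono mult_left_mono) auto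
    with C(2)[OF m] SI m
    have "SI_error t (A m) (b m) (V m) \<le> C * H_e \<alpha> ^ m * vec_norm2 (b m)"
      by (fastforce simp: mult_ac)
    thus "SI_error t (A m) (b m) (V m) / vec_norm2 (b m) \<le> C * H_e \<alpha> ^ m"
      using b by (simp add: pos_divide_le_eq)
  qed
next
  have "0 < 1 / sqrt (2::real)" by simp
  from SI_error_saddle_bound[OF this optimal_below_critical assms] obtain C where C: "C > 0"
    "\<And>m n A b V. m \<ge> 1 \<Longrightarrow> SI_setup m (1 / sqrt 2 * real m / t) n A b V \<Longrightarrow>
       SI_error t A b V \<le> C * vec_norm2 b * real m powr (- 1 / 2) * (sqrt 2 - 1) ^ m"
    unfolding H_e_optimal by blast
  have "\<forall>\<^sub>F m in sequentially. SI_error t (A m) (b m) (V m)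
          \<le> C * vec_norm2 (b m) * real m powr (- 1 / 2) * (sqrt 2 - 1) ^ m"
    if SI: "\<forall>m\<ge>1. SI_setup m (1 / sqrt 2 * real m / t) (n m) (A m) (b m) (V m)"
    for n :: "nat \<Rightarrow> nat" and A b V
    using eventually_ge_at_top[of "1::nat"]
  proof eventually_elim
    case (elim m)
    show ?case by (rule C(2)[OF elim]) (use SI elim in blast)
  qed
  thus "\<exists>C>0. \<forall>(n :: nat \<Rightarrow> nat) A b V.
          (\<forall>m\<ge>1. SI_setup m (1 / sqrt 2 * real m / t) (n m) (A m) (b m) (V m)) \<longrightarrow>
          (\<forall>\<^sub>F m in sequentially. SI_error t (A m) (b m) (V m)
             \<le> C * vec_norm2 (b m) * real m powr (- 1 / 2) * (sqrt 2 - 1) ^ m)"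
    using C(1) by blast
qed

end
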